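(* There exists a universal constant $c>0$ such that for all integers $n\ge 1$ and $1\le t\le n$ there exists a non-empty $t$-wise permutation $T\subset S_n$ satisfying $|T|\le \exp(t^{c})\,n^{ct}$.
   Context: $S_n$ is the set of permutations of $[n]=\{1,\ldots,n\}$. A family of permutations $T\subset S_n$ is called a $t$-wise permutation if for any distinct elements $i_1,\ldots,i_t\in[n]$ and any distinct elements $j_1,\ldots,j_t\in[n]$, $$|\{\pi\in T:\pi(i_1)=j_1,\ldots,\pi(i_t)=j_t\}|=\frac{1}{n(n-1)\cdots(n-t+1)}|T|.$$ *)

theory Defs
  imports Complex_Main "HOL-Combinatorics.Permutations"
begin

definition perms_of :: "nat \<Rightarrow> (nat \<Rightarrow> nat) set" where
  "perms_of n = {\<pi>. \<pi> permutes {1..n}}"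

text \<open>
  A \<open>t\<close>-tuple of distinct elements of \<open>[n]\<close> is a distinct list of length \<open>t\<close> over \<open>{1..n}\<close>;
  the entries \<open>i\<^sub>1, \<dots>, i\<^sub>t\<close> are \<open>is ! 0, \<dots>, is ! (t - 1)\<close>.
\<close>

definition distinct_tuples :: "nat \<Rightarrow> nat \<Rightarrow> nat list set" where
  "distinct_tuples n t = {xs. length xs = t \<and> distinct xs \<and> set xs \<subseteq> {1..n}}"

definition t_wise_permutation :: "nat \<Rightarrow> nat \<Rightarrow> (nat \<Rightarrow> nat) set \<Rightarrow> bool" where
  "t_wise_permutation n t T \<longleftrightarrow>
     T \<subseteq> perms_of n \<and>
     (\<forall>is \<in> distinct_tuples n t. \<forall>js \<in> distinct_tuples n t.
        real (card {\<pi> \<in> T. \<forall>k<t. \<pi> (is ! k) = js ! k})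
          = 1 / (\<Prod>k<t. real n - real k) * real (card T))"

end

theory Submission
  imports Defs "HOL-Library.FuncSet" "HOL-Computational_Algebra.Polynomial"
begin

text \<open>
  Call a multiset of permutations of a finite set \<open>A\<close> uniform up to order \<open>t\<close> if every pattern
  \<open>L\<close> of at most \<open>t\<close> prescribed values \<open>\<pi> a = b\<close> is hit with the same frequency as in the full
  symmetric group. If \<open>n\<close> is at most polynomial in \<open>t\<close>, the symmetric group itself is small enough
  (\<open>small_ground_set\<close>). For larger \<open>n\<close> the proof starts from a random-like multiset, which is only
  approximately uniform, and repairs the errors exactly. The repair must use integers of controlled
  size, and this is the heart of the matter.

  The tool is the lemma \<open>reconstruction\<close>: up to a factor depending on \<open>t\<close>, there are
  \<open>n\<close> to the power \<open>O(t)\<close> fixed permutations \<open>b\<close>, each with a sign and a pattern \<open>P\<close> of order at most \<open>2 t\<close>, such that \<^emph>\<open>every\<close>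
  permutation \<open>\<pi>\<close> satisfies \<open>Q * hits L \<pi> = (\<Sum> sign * hits P \<pi> * hits L b)\<close> for all \<open>L\<close> of order at
  most \<open>t\<close>. So, as far as such patterns can see, \<open>Q\<close> copies of \<open>\<pi>\<close> are a signed combination of
  the \<open>b\<close>, and, what matters most, the coefficients are themselves pattern statistics of \<open>\<pi>\<close>.
  It rests on two observations.

  \<^item> Fix a buffer \<open>W\<close> of \<open>2 t\<close> points. For a small set \<open>T\<close> of points outside \<open>W\<close>, let a surgered
    permutation keep the values of \<open>\<pi>\<close> inside \<open>T\<close>, fix all other points outside \<open>W\<close>, and use
    \<open>W\<close> to close up what was cut. Whether it hits a pattern that avoids \<open>W\<close> depends only on the at
    most \<open>2 t\<close> elements of \<open>T\<close> mentioned by the pattern, so Moebius inversion over \<open>T\<close> recovers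
    the value at \<open>\<pi>\<close> (\<open>interpolation_off_buffer\<close>). After averaging over all permutations of \<open>W\<close> on
    both sides, patterns that meet \<open>W\<close> are linear combinations of patterns that avoid it, and the
    restriction disappears (\<open>symm_hits_identity\<close>).

  \<^item> The averaging is removed with \<open>2 t + 1\<close> disjoint buffers. A pattern mentions at most \<open>2 t\<close> points
    and so misses one buffer, for which averaging changes nothing. Hence the product of the operators
    \<open>1 - averaging over W\<^sub>j\<close> annihilates everything (\<open>alternating_masks_vanish\<close>), and multiplying it
    out writes the identity as a signed sum of averages.

  Now take \<open>r\<close> translates \<open>g\<^sub>i\<close> that are balanced to within the square root of \<open>r\<close>
  (\<open>balanced_sequence\<close>), and the multiset of all \<open>g\<^sub>i \<circ> b\<close>. By \<open>reconstruction\<close> in the \<open>i\<close>-th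
  translate, its deviation from uniformity is a combination of the \<open>g\<^sub>i \<circ> b\<close> with coefficients of
  the order of the square root of \<open>r\<close>. Averaging this over \<open>i\<close> spreads the correction so thinly that for
  large \<open>r\<close> all weights stay nonnegative: \<open>exact_weights\<close> gives an exactly uniform multiset of
  size \<open>n\<close> to the power \<open>O(t)\<close>, up to a factor depending on \<open>t\<close>.

  Finally the multiset is turned into a set. Copies of \<open>\<pi>\<close> are composed with permutations of many
  disjoint blocks, the choices in the blocks being the values of a polynomial modulo \<open>M\<close>. The high
  coefficients number the copies, and the \<open>t\<close> low ones run over all values; since any \<open>t\<close> values
  of such a polynomial are then equidistributed, no pattern of order \<open>t\<close> can see which copy was used
  (\<open>spread_weights\<close>).
\<close>

section \<open>Patterns and their frequencies\<close>

definition hits :: "('a \<times> 'a) set \<Rightarrow> ('a \<Rightarrow> 'a) \<Rightarrow> real" where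
  "hits K \<pi> = of_bool (\<forall>(a, b)\<in>K. \<pi> a = b)"

definition partial_inj :: "('a \<times> 'b) set \<Rightarrow> bool" where
  "partial_inj K \<longleftrightarrow> inj_on fst K \<and> inj_on snd K"

definition patterns :: "'a set \<Rightarrow> nat \<Rightarrow> ('a \<times> 'a) set set" where
  "patterns A k = {K. K \<subseteq> A \<times> A \<and> card K \<le> k}"

definition freq :: "'a set \<Rightarrow> ('a \<times> 'a) set \<Rightarrow> real" where
  "freq A K = (\<Sum>\<pi> | \<pi> permutes A. hits K \<pi>) / fact (card A)"

lemma hits_nonneg: "0 \<le> hits K \<pi>" and hits_le_one: "hits K \<pi> \<le> 1"
  by (simp_all add: hits_def)

lemma hits_in_Ints: "hits K \<pi> \<in> \<int>"
  by (simp add: hits_def)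

lemma hits_insert: "hits (insert (a, b) K) \<pi> = of_bool (\<pi> a = b) * hits K \<pi>"
  by (auto simp: hits_def)

lemma hits_empty [simp]: "hits {} \<pi> = 1"
  by (simp add: hits_def)

lemma hits_comp_right: "hits K (\<pi> \<circ> h) = hits (map_prod h id ` K) \<pi>"
  by (auto simp: hits_def case_prod_beta)

lemma hits_comp_left:
  assumes "bij g"
  shows "hits K (g \<circ> \<pi>) = hits (map_prod id (inv g) ` K) \<pi>"
proof -
  have "g (\<pi> a) = b \<longleftrightarrow> \<pi> a = inv g b" for a b
    using assms by (metis bij_inv_eq_iff)
  then show ?thesis
    by (auto simp: hits_def case_prod_beta)
qed

lemma hits_inv:
  assumes "bij \<pi>"
  shows "hits K (inv \<pi>) = hits (prod.swap ` K) \<pi>"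
proof -
  have "inv \<pi> a = b \<longleftrightarrow> \<pi> b = a" for a b
    using assms by (metis bij_inv_eq_iff)
  then show ?thesis
    by (auto simp: hits_def case_prod_beta)
qed

lemma hits_eq_zero_if_not_partial_inj:
  assumes "inj \<pi>" "\<not> partial_inj K"
  shows "hits K \<pi> = 0"
proof (rule ccontr)
  assume "hits K \<pi> \<noteq> 0"
  then have "\<pi> (fst p) = snd p" if "p \<in> K" for p
    using that by (auto simp: hits_def case_prod_beta split: if_splits)
  then have "partial_inj K"
    unfolding partial_inj_def inj_on_def
    using injD[OF assms(1)] by (metis prod.expand)
  with assms(2) show False ..
qed

lemma partial_inj_subset: "partial_inj K \<Longrightarrow> L \<subseteq> K \<Longrightarrow> partial_inj L"
  unfolding partial_inj_def by (meson inj_on_subset)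

lemma patternsD:
  assumes "K \<in> patterns A k" "finite A"
  shows "finite K" "K \<subseteq> A \<times> A" "card K \<le> k"
  using assms by (auto simp: patterns_def intro: finite_subset)

lemma finite_patterns: "finite A \<Longrightarrow> finite (patterns A k)"
  by (rule finite_subset[of _ "Pow (A \<times> A)"]) (auto simp: patterns_def)

lemma map_prod_in_patterns:
  assumes "K \<in> patterns A k" "finite A" "g ` A \<subseteq> A" "h ` A \<subseteq> A"
  shows "map_prod g h ` K \<in> patterns A k"
  using patternsD[OF assms(1,2)] assms(3,4) card_image_le[of K "map_prod g h"]
  unfolding patterns_def by auto

lemma sum_hits_over_value:
  assumes "finite A" "\<pi> permutes A" "a \<in> A"
  shows "(\<Sum>y\<in>A. hits (insert (a, y) K) \<pi>) = hits K \<pi>"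
proof -
  have "(\<Sum>y\<in>A. hits (insert (a, y) K) \<pi>) = (\<Sum>y\<in>{\<pi> a}. hits K \<pi>)"
    using assms permutes_in_image[OF assms(2), of a]
    by (intro sum.mono_neutral_cong_right) (auto simp: hits_insert)
  then show ?thesis by simp
qed

lemma permutes_of_inj_on:
  assumes "finite A" "B \<subseteq> A" "inj_on f B" "f ` B \<subseteq> A"
  obtains p where "p permutes A" "\<And>x. x \<in> B \<Longrightarrow> p x = f x"
proof -
  have fin: "finite B" using assms finite_subset by blast
  have "card (A - B) = card (A - f ` B)"
    using assms fin by (simp add: card_Diff_subset card_image)
  then obtain g where g: "bij_betw g (A - B) (A - f ` B)"
    using assms(1) finite_same_card_bij by (metis finite_Diff)
  define p where "p x = (if x \<in> B then f x else if x \<in> A then g x else x)" for x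
  have "bij_betw p B (f ` B)"
    using assms(3) by (intro bij_betw_imageI) (auto simp: p_def inj_on_def)
  moreover have "bij_betw p (A - B) (A - f ` B)"
    using g by (rule bij_betw_cong[THEN iffD1, rotated]) (auto simp: p_def)
  ultimately have "bij_betw p (B \<union> (A - B)) (f ` B \<union> (A - f ` B))"
    by (rule bij_betw_combine) auto
  then have "bij_betw p A A"
    using assms by (simp add: Un_absorb1)
  then have "p permutes A"
    using assms(2) by (intro bij_imp_permutes) (auto simp: p_def)
  then show thesis
    using that by (simp add: p_def)
qed

lemma freq_map_prod_right:
  assumes "h permutes A"
  shows "freq A (map_prod h id ` K) = freq A K"
  unfolding freq_def hits_comp_right[symmetric]
  by (simp add: sum_permutations_compose_right[OF assms, symmetric])

lemma freq_map_prod_left: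
  assumes "g permutes A"
  shows "freq A (map_prod id g ` K) = freq A K"
proof -
  have "inv g permutes A" "bij (inv g)" "inv (inv g) = g"
    using assms by (auto simp: permutes_inv permutes_inv_inv intro: permutes_bij permutes_inv)
  then show ?thesis
    unfolding freq_def
    using hits_comp_left[of "inv g" K] setum_permutations_compose_left[of "inv g" A "hits K"]
    by (simp add: comp_def)
qed

lemma transpose_fixes_pattern:
  assumes "b \<notin> snd ` K" "y \<notin> snd ` K"
  shows "map_prod id (transpose b y) ` insert (a, b) K = insert (a, y) K"
proof -
  have "map_prod id (transpose b y) z = z" if "z \<in> K" for z
    using that assms by (cases z) (auto simp: transpose_def image_iff)
  then have "map_prod id (transpose b y) ` K = K"
    by simp
  then show ?thesis by simp
qed

lemma freq_not_partial_inj: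
  assumes "\<not> partial_inj K"
  shows "freq A K = 0"
proof -
  have "hits K \<pi> = 0" if "\<pi> permutes A" for \<pi>
    using hits_eq_zero_if_not_partial_inj[OF permutes_inj[OF that] assms] .
  then show ?thesis by (simp add: freq_def)
qed

lemma partial_inj_insertD:
  assumes "partial_inj (insert (a, b) K)" "(a, b) \<notin> K"
  shows "a \<notin> fst ` K" "b \<notin> snd ` K" "partial_inj K"
proof -
  have eq: "p = (a, b)" if "p \<in> K" "fst p = a \<or> snd p = b" for p
    using assms(1) that inj_onD[of fst "insert (a, b) K" p "(a, b)"]
      inj_onD[of snd "insert (a, b) K" p "(a, b)"] by (simp add: partial_inj_def) blast
  show "a \<notin> fst ` K"
    using eq assms(2) by (metis imageE)
  show "b \<notin> snd ` K"
    using eq assms(2) by (metis imageE)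
  show "partial_inj K"
    using assms(1) partial_inj_subset by blast
qed

lemma not_partial_inj_insert:
  assumes "a \<notin> fst ` K" "y \<in> snd ` K"
  shows "\<not> partial_inj (insert (a, y) K)"
proof
  assume *: "partial_inj (insert (a, y) K)"
  from assms(2) obtain c where "(c, y) \<in> K" by auto
  then show False
    using * assms(1) inj_onD[of snd "insert (a, y) K" "(c, y)" "(a, y)"]
    by (force simp: partial_inj_def)
qed

text \<open>
  The values \<open>y\<close> that are still free at a new point all have the same frequency by symmetry,
  and together they exhaust the frequency of the smaller pattern.
\<close>

lemma freq_partial_inj:
  assumes "finite A" "K \<subseteq> A \<times> A" "partial_inj K"
  shows "freq A K = 1 / (\<Prod>k<card K. real (card A) - real k)"
proof -
  have "finite K" using assms finite_subset by blast
  then show ?thesis using assms(2,3)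
  proof (induction K)
    case empty
    have "card {\<pi>. \<pi> permutes A} = fact (card A)"
      using card_permutations[OF refl assms(1)] .
    then show ?case by (simp add: freq_def)
  next
    case (insert p K)
    obtain a b where p: "p = (a, b)" by (cases p)
    note new = partial_inj_insertD[OF insert.prems(2)[unfolded p] insert.hyps(2)[unfolded p]]
    have IH: "freq A K = 1 / (\<Prod>k<card K. real (card A) - real k)"
      using insert new by auto
    have ab: "a \<in> A" "b \<in> A" "snd ` K \<subseteq> A" using insert.prems p by auto
    have cs: "card (snd ` K) = card K"
      using new(3) by (simp add: partial_inj_def card_image)
    have "card (insert b (snd ` K)) \<le> card A"
      using ab assms(1) by (intro card_mono) auto
    then have less: "card K < card A"
      using new(2) cs insert.hyps(1) by simp
    have "freq A K = (\<Sum>\<pi> | \<pi> permutes A. \<Sum>y\<in>A. hits (insert (a, y) K) \<pi>) / fact (card A)"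
      using sum_hits_over_value[OF assms(1) _ ab(1)] by (simp add: freq_def)
    also have "\<dots> = (\<Sum>y\<in>A. freq A (insert (a, y) K))"
      by (subst sum.swap) (simp add: freq_def sum_divide_distrib)
    also have "\<dots> = (\<Sum>y\<in>A - snd ` K. freq A (insert (a, y) K))"
      using assms(1) freq_not_partial_inj[OF not_partial_inj_insert[OF new(1)]]
      by (intro sum.mono_neutral_right) blast+
    also have "\<dots> = (\<Sum>y\<in>A - snd ` K. freq A (insert (a, b) K))"
    proof (intro sum.cong refl)
      fix y assume "y \<in> A - snd ` K"
      then show "freq A (insert (a, y) K) = freq A (insert (a, b) K)"
        using freq_map_prod_left[OF permutes_swap_id, of b A y "insert (a, b) K"] ab new
          transpose_fixes_pattern[of b K y a] by simp
    qed
    also have "\<dots> = (real (card A) - real (card K)) * freq A (insert p K)"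
      using ab(3) less insert.hyps(1) cs p by (simp add: card_Diff_subset)
    finally have "(real (card A) - real (card K)) * freq A (insert p K)
      = 1 / (\<Prod>k<card K. real (card A) - real k)"
      using IH by simp
    then have "freq A (insert p K) = 1 / ((\<Prod>k<card K. real (card A) - real k) * (real (card A) - real (card K)))"
      using less by (simp add: field_simps)
    then show ?case
      using insert.hyps by simp
  qed
qed

section \<open>Alternating sums over subsets\<close>

text \<open>
  Inserting or removing \<open>x\<close> pairs the subsets of \<open>V\<close> into terms of opposite sign.
\<close>

lemma alternating_sum_toggle:
  fixes q :: "'a set \<Rightarrow> real"
  assumes "finite V" "x \<in> V" "\<And>T. T \<subseteq> V - {x} \<Longrightarrow> q (insert x T) = q T"
  shows "(\<Sum>T\<in>Pow V. (-1) ^ card T * q T) = 0"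
proof -
  let ?P = "Pow (V - {x})"
  have "Pow V = ?P \<union> insert x ` ?P"
    using assms(2) Pow_insert[of x "V - {x}"] by (simp add: insert_absorb)
  moreover have "finite ?P" "?P \<inter> insert x ` ?P = {}"
    using assms(1) by auto
  ultimately have "(\<Sum>T\<in>Pow V. (-1) ^ card T * q T)
    = (\<Sum>T\<in>?P. (-1) ^ card T * q T) + (\<Sum>T\<in>insert x ` ?P. (-1) ^ card T * q T)"
    using sum.union_disjoint[of ?P "insert x ` ?P"] by simp
  also have "(\<Sum>T\<in>insert x ` ?P. (-1) ^ card T * q T)
    = (\<Sum>T\<in>?P. (-1) ^ card (insert x T) * q (insert x T))"
    by (subst sum.reindex) (auto simp: inj_on_def)
  also have "\<dots> = (\<Sum>T\<in>?P. - ((-1) ^ card T * q T))"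
  proof (intro sum.cong refl)
    fix T assume T: "T \<in> ?P"
    then have "finite T" "x \<notin> T"
      using assms(1) by (auto intro: finite_subset)
    then show "(-1) ^ card (insert x T) * q (insert x T) = - ((-1) ^ card T * q T)"
      using assms(3) T by simp
  qed
  finally show ?thesis by (simp add: sum_negf)
qed

lemma mobius_resummation:
  fixes q :: "'a set \<Rightarrow> real"
  assumes "finite U"
  shows "(\<Sum>V\<in>Pow U. \<Sum>T\<in>Pow V. (-1) ^ (card V + card T) * q T) = q U"
proof -
  have "(\<Sum>V\<in>Pow U. \<Sum>T\<in>Pow V. (-1) ^ (card V + card T) * q T)
    = (\<Sum>V\<in>Pow U. \<Sum>T\<in>Pow U. if T \<subseteq> V then (-1) ^ (card V + card T) * q T else 0)"
    using assms
    by (intro sum.cong refl sum.mono_neutral_cong_left) (auto intro: finite_subset)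
  also have "\<dots> = (\<Sum>T\<in>Pow U. \<Sum>V\<in>Pow U. (-1) ^ card V * ((-1) ^ card T * (if T \<subseteq> V then q T else 0)))"
    by (subst sum.swap, intro sum.cong refl) (simp add: power_add)
  also have "\<dots> = (\<Sum>T\<in>{U}. q T)"
  proof (intro sum.mono_neutral_cong_right ballI)
    fix T assume T: "T \<in> Pow U - {U}"
    then obtain x where x: "x \<in> U" "x \<notin> T" by auto
    show "(\<Sum>V\<in>Pow U. (-1) ^ card V * ((-1) ^ card T * (if T \<subseteq> V then q T else 0))) = 0"
      using x assms by (intro alternating_sum_toggle[of U x]) (auto simp: subset_insert)
  next
    fix T assume "T \<in> {U}"
    then have T: "T = U" by simp
    have "(\<Sum>V\<in>Pow U. (-1) ^ card V * ((-1) ^ card T * (if T \<subseteq> V then q T else 0)))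
      = (\<Sum>V\<in>{U}. (-1) ^ card V * ((-1) ^ card T * q T))"
      using assms T by (intro sum.mono_neutral_cong_right) auto
    then show "(\<Sum>V\<in>Pow U. (-1) ^ card V * ((-1) ^ card T * (if T \<subseteq> V then q T else 0))) = q T"
      using T by (simp flip: mult.assoc power_add)
  qed (use assms in auto)
  finally show ?thesis by simp
qed

text \<open>
  Moebius inversion may be truncated at order \<open>k\<close> when the function depends on at most \<open>k\<close> elements:
  the inner alternating sum vanishes as soon as \<open>V\<close> contains an irrelevant element.
\<close>

lemma truncated_mobius:
  fixes q :: "'a set \<Rightarrow> real"
  assumes "finite N" "U \<subseteq> N" "card U \<le> k"
  shows "(\<Sum>V | V \<subseteq> N \<and> card V \<le> k. \<Sum>T\<in>Pow V. (-1) ^ (card V + card T) * q (T \<inter> U)) = q U"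
proof -
  have finU: "finite U" using assms finite_subset by blast
  have "(\<Sum>V | V \<subseteq> N \<and> card V \<le> k. \<Sum>T\<in>Pow V. (-1) ^ (card V + card T) * q (T \<inter> U))
    = (\<Sum>V\<in>Pow U. \<Sum>T\<in>Pow V. (-1) ^ (card V + card T) * q T)"
  proof (rule sum.mono_neutral_cong_right)
    show "finite {V. V \<subseteq> N \<and> card V \<le> k}"
      using assms(1) by (auto intro: finite_subset[of _ "Pow N"])
    show "Pow U \<subseteq> {V. V \<subseteq> N \<and> card V \<le> k}"
      using assms finU card_mono le_trans by blast
    show "\<forall>V\<in>{V. V \<subseteq> N \<and> card V \<le> k} - Pow U.
      (\<Sum>T\<in>Pow V. (-1) ^ (card V + card T) * q (T \<inter> U)) = 0"
    proof
    fix V assume V: "V \<in> {V. V \<subseteq> N \<and> card V \<le> k} - Pow U"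
    then obtain x where x: "x \<in> V" "x \<notin> U" by auto
    have "finite V" using V assms(1) finite_subset by blast
    then have "(\<Sum>T\<in>Pow V. (-1) ^ card T * ((-1) ^ card V * q (T \<inter> U))) = 0"
      using x by (intro alternating_sum_toggle[of V x]) auto
    then show "(\<Sum>T\<in>Pow V. (-1) ^ (card V + card T) * q (T \<inter> U)) = 0"
      by (simp add: power_add mult_ac)
    qed
  next
    fix V assume "V \<in> Pow U"
    then show "(\<Sum>T\<in>Pow V. (-1) ^ (card V + card T) * q (T \<inter> U))
      = (\<Sum>T\<in>Pow V. (-1) ^ (card V + card T) * q T)"
      by (intro sum.cong refl) (auto simp: Int_absorb2 subset_trans)
  qed
  also have "\<dots> = q U" using mobius_resummation[OF finU] .
  finally show ?thesis .
qed

section \<open>Local perturbations of the identity\<close>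

text \<open>
  Throughout, \<open>W\<close> is a buffer: a set of points in which no value is ever prescribed, so that partial
  permutations of the rest can be closed up inside it.
\<close>

definition graph_on :: "('a \<Rightarrow> 'b) \<Rightarrow> 'a set \<Rightarrow> ('a \<times> 'b) set" where
  "graph_on \<pi> V = (\<lambda>v. (v, \<pi> v)) ` V"

text \<open>
  \<open>K\<close> prescribes values on \<open>V = fst ` K\<close>. Only its arcs that stay inside \<open>V\<close> are kept, and a point of
  \<open>V\<close> whose prescribed value leaves \<open>V\<close> must be sent into the buffer. The values on the buffer itself
  are left open, because later only averages over permutations of \<open>W\<close> enter.
\<close>

definition surgery_spec :: "'a set \<Rightarrow> 'a set \<Rightarrow> ('a \<times> 'a) set \<Rightarrow> ('a \<Rightarrow> 'a) \<Rightarrow> bool" where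
  "surgery_spec A W K \<beta> \<longleftrightarrow> \<beta> permutes A \<and>
     (\<forall>a\<in>A - W. \<forall>b\<in>A - W. \<beta> a = b \<longleftrightarrow>
        (if a \<in> fst ` K then (a, b) \<in> K \<and> b \<in> fst ` K else a = b))"

definition surgery :: "'a set \<Rightarrow> 'a set \<Rightarrow> ('a \<times> 'a) set \<Rightarrow> 'a \<Rightarrow> 'a" where
  "surgery A W K = (SOME \<beta>. surgery_spec A W K \<beta>)"

text \<open>
  At most \<open>card K\<close> points have to be sent into \<open>W\<close>, which is possible injectively as \<open>W\<close> is at least
  that large; any injective map outside \<open>W\<close> then extends to a permutation.
\<close>

lemma surgery_spec_ex:
  assumes A: "finite A" "W \<subseteq> A" and K: "K \<subseteq> A \<times> A" "partial_inj K"
    and sub: "fst ` K \<subseteq> A - W" and size: "card K \<le> card W"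
  shows "\<exists>\<beta>. surgery_spec A W K \<beta>"
proof -
  define V where "V = fst ` K"
  have finK: "finite K" using A(1) K(1) finite_subset by blast
  have "\<exists>c. (v, c) \<in> K" if "v \<in> V" for v
    using that by (auto simp: V_def)
  then obtain f where f: "(v, f v) \<in> K" if "v \<in> V" for v by metis
  have Kf: "(v, c) \<in> K \<longleftrightarrow> v \<in> V \<and> c = f v" for v c
  proof
    assume vc: "(v, c) \<in> K"
    then have v: "v \<in> V" by (force simp: V_def)
    then show "v \<in> V \<and> c = f v"
      using vc f[OF v] K(2) inj_onD[of fst K "(v, c)" "(v, f v)"] by (simp add: partial_inj_def)
  next
    assume "v \<in> V \<and> c = f v"
    then show "(v, c) \<in> K" using f[of v] by simp
  qed
  have f_inj: "inj_on f V"
  proof (rule inj_onI)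
    fix x y assume "x \<in> V" "y \<in> V" "f x = f y"
    then show "x = y"
      using f[of x] f[of y] K(2) inj_onD[of snd K "(x, f x)" "(y, f y)"] by (simp add: partial_inj_def)
  qed
  have fA: "f ` V \<subseteq> A" using f K(1) by blast
  define X where "X = {v \<in> V. f v \<notin> V}"
  have finV: "finite V" "card V \<le> card W"
    using finK size card_image_le[OF finK, of fst] by (auto simp: V_def)
  have "card X \<le> card W"
    using finV card_mono[of V X] by (simp add: X_def)
  moreover have "finite X" "finite W"
    using finV(1) finite_subset[OF A(2,1)] by (simp_all add: X_def)
  ultimately obtain j where j: "j ` X \<subseteq> W" "inj_on j X"
    using card_le_inj[of X W] by auto
  define h where "h a = (if a \<in> X then j a else if a \<in> V then f a else a)" for a
  have V: "V \<subseteq> A - W" using sub by (simp add: V_def)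
  have "inj_on h (A - W)"
  proof (rule inj_onI)
    fix x y assume xy: "x \<in> A - W" "y \<in> A - W" "h x = h y"
    have jW: "j a \<in> W" if "a \<in> X" for a using j(1) that by blast
    consider "x \<in> X" "y \<in> X" | "x \<notin> X" "y \<notin> X" | "x \<in> X" "y \<notin> X" | "x \<notin> X" "y \<in> X"
      by blast
    then show "x = y"
    proof cases
      case 1
      then show ?thesis using xy(3) inj_onD[OF j(2), of x y] by (simp add: h_def)
    next
      case 2
      then show ?thesis
        using xy inj_onD[OF f_inj, of x y] by (auto simp: h_def X_def split: if_splits)
    next
      case 3
      then have "j x \<in> W" using jW by simp
      moreover have "h y \<notin> W"
        using 3 xy(2) V by (auto simp: h_def X_def)
      ultimately have "j x \<in> W" "h y \<notin> W" by simp_all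
      with 3 xy(3) show ?thesis by (simp add: h_def)
    next
      case 4
      then have "j y \<in> W" using jW by simp
      moreover have "h x \<notin> W"
        using 4 xy(1) V by (auto simp: h_def X_def)
      ultimately have "j y \<in> W" "h x \<notin> W" by simp_all
      with 4 xy(3) show ?thesis by (simp add: h_def)
    qed
  qed
  moreover have "h ` (A - W) \<subseteq> A"
    using j(1) fA A(2) by (auto simp: h_def)
  ultimately obtain \<beta> where \<beta>: "\<beta> permutes A" "\<And>x. x \<in> A - W \<Longrightarrow> \<beta> x = h x"
    using permutes_of_inj_on[OF A(1), of "A - W" h] by auto
  have "\<beta> a = b \<longleftrightarrow> (if a \<in> fst ` K then (a, b) \<in> K \<and> b \<in> fst ` K else a = b)"
    if ab: "a \<in> A - W" "b \<in> A - W" for a b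
  proof -
    have "j a \<in> W" if "a \<in> X" using j(1) that by auto
    then show ?thesis
      using ab \<beta>(2)[of a] unfolding V_def[symmetric] Kf by (auto simp: h_def X_def)
  qed
  then show ?thesis
    using \<beta>(1) unfolding surgery_spec_def by blast
qed

lemma surgery:
  assumes "finite A" "W \<subseteq> A" "K \<subseteq> A \<times> A" "partial_inj K" "fst ` K \<subseteq> A - W" "card K \<le> card W"
  shows "surgery_spec A W K (surgery A W K)"
  unfolding surgery_def using someI_ex[OF surgery_spec_ex[OF assms]] .

lemma graph_on_facts:
  assumes "\<pi> permutes A" "V \<subseteq> A" "finite A"
  shows "fst ` graph_on \<pi> V = V" "card (graph_on \<pi> V) = card V" "partial_inj (graph_on \<pi> V)"
    "graph_on \<pi> V \<subseteq> A \<times> A" "(a, b) \<in> graph_on \<pi> V \<longleftrightarrow> a \<in> V \<and> b = \<pi> a"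
proof -
  show "fst ` graph_on \<pi> V = V" by (force simp: graph_on_def)
  show "card (graph_on \<pi> V) = card V"
    unfolding graph_on_def by (intro card_image) (auto simp: inj_on_def)
  show "partial_inj (graph_on \<pi> V)"
    using permutes_inj[OF assms(1)] by (auto simp: graph_on_def partial_inj_def inj_on_def)
  show "graph_on \<pi> V \<subseteq> A \<times> A"
    using assms permutes_in_image[OF assms(1)] by (auto simp: graph_on_def)
  show "(a, b) \<in> graph_on \<pi> V \<longleftrightarrow> a \<in> V \<and> b = \<pi> a" by (auto simp: graph_on_def)
qed

lemma surgery_graph:
  assumes "finite A" "W \<subseteq> A" "\<pi> permutes A" "V \<subseteq> A - W" "card V \<le> card W"
  shows "surgery A W (graph_on \<pi> V) permutes A"
    "\<And>a b. a \<in> A - W \<Longrightarrow> b \<in> A - W \<Longrightarrow>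
       surgery A W (graph_on \<pi> V) a = b \<longleftrightarrow> (if a \<in> V then b \<in> V \<and> \<pi> a = b else a = b)"
proof -
  have V: "V \<subseteq> A" using assms by auto
  note g = graph_on_facts[OF assms(3) V assms(1)]
  have s: "surgery_spec A W (graph_on \<pi> V) (surgery A W (graph_on \<pi> V))"
    using assms g by (intro surgery) auto
  show "surgery A W (graph_on \<pi> V) permutes A"
    using s by (simp add: surgery_spec_def)
  show "surgery A W (graph_on \<pi> V) a = b \<longleftrightarrow> (if a \<in> V then b \<in> V \<and> \<pi> a = b else a = b)"
    if "a \<in> A - W" "b \<in> A - W" for a b
    using s that g(1,5) unfolding surgery_spec_def by auto
qed

text \<open>
  A pattern mentioning only the points of \<open>U\<close>, \<open>card U \<le> 2 t\<close>, sees the surgered permutation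
  only through \<open>T \<inter> U\<close>, and for \<open>T = U\<close> it sees \<open>\<pi>\<close> itself; this is the situation of
  \<open>truncated_mobius\<close>.
\<close>

lemma interpolation_off_buffer:
  assumes A: "finite A" "W \<subseteq> A" "2 * t \<le> card W" and \<pi>: "\<pi> permutes A"
    and L: "L \<in> patterns (A - W) t"
  shows "(\<Sum>V | V \<subseteq> A - W \<and> card V \<le> 2 * t. \<Sum>T\<in>Pow V.
            (-1) ^ (card V + card T) * hits L (surgery A W (graph_on \<pi> T))) = hits L \<pi>"
proof -
  have L': "finite L" "L \<subseteq> (A - W) \<times> (A - W)" "card L \<le> t"
    using patternsD[OF L] A(1) by auto
  define U where "U = fst ` L \<union> snd ` L"
  have U: "U \<subseteq> A - W" using L' by (auto simp: U_def)
  have "card U \<le> card (fst ` L) + card (snd ` L)"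
    unfolding U_def by (rule card_Un_le)
  then have cU: "card U \<le> 2 * t"
    using card_image_le[OF L'(1), of fst] card_image_le[OF L'(1), of snd] L'(3) by linarith
  define q :: "'a set \<Rightarrow> real" where
    "q T = of_bool (\<forall>(a, b)\<in>L. if a \<in> T then b \<in> T \<and> \<pi> a = b else a = b)" for T
  have "(\<Sum>V | V \<subseteq> A - W \<and> card V \<le> 2 * t. \<Sum>T\<in>Pow V.
            (-1) ^ (card V + card T) * hits L (surgery A W (graph_on \<pi> T)))
    = (\<Sum>V | V \<subseteq> A - W \<and> card V \<le> 2 * t. \<Sum>T\<in>Pow V.
            (-1) ^ (card V + card T) * q (T \<inter> U))"
  proof (intro sum.cong refl arg_cong2[where f = "(*)"])
    fix V T assume V: "V \<in> {V. V \<subseteq> A - W \<and> card V \<le> 2 * t}" and T: "T \<in> Pow V"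
    have "finite V" using V A(1) finite_subset by blast
    then have "card T \<le> card W" using T V A(3) card_mono[of V T] by auto
    then have s: "surgery A W (graph_on \<pi> T) a = b \<longleftrightarrow> (if a \<in> T then b \<in> T \<and> \<pi> a = b else a = b)"
      if "(a, b) \<in> L" for a b
      using surgery_graph(2)[OF A(1,2) \<pi>, of T a b] V T that L'(2) by auto
    have "(\<forall>(a, b)\<in>L. surgery A W (graph_on \<pi> T) a = b)
      \<longleftrightarrow> (\<forall>(a, b)\<in>L. if a \<in> T \<inter> U then b \<in> T \<inter> U \<and> \<pi> a = b else a = b)"
    proof (intro ball_cong refl, clarify)
      fix a b assume ab: "(a, b) \<in> L"
      then have "a \<in> U" "b \<in> U" unfolding U_def by force+
      then show "surgery A W (graph_on \<pi> T) a = b \<longleftrightarrow>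
          (if a \<in> T \<inter> U then b \<in> T \<inter> U \<and> \<pi> a = b else a = b)"
        using s[OF ab] by simp
    qed
    then show "hits L (surgery A W (graph_on \<pi> T)) = q (T \<inter> U)"
      unfolding hits_def q_def by simp
  qed
  also have "\<dots> = q U"
    using A(1) U cU by (intro truncated_mobius) auto
  also have "\<dots> = hits L \<pi>"
  proof -
    have "a \<in> U \<and> b \<in> U" if "(a, b) \<in> L" for a b
      using that unfolding U_def by force
    then show ?thesis
      unfolding q_def hits_def by (intro arg_cong[where f = of_bool] ball_cong refl) auto
  qed
  finally show ?thesis .
qed

section \<open>Symmetrisation over a buffer\<close>

text \<open>
  Averaging over the buffer on both sides, here without normalisation, is what makes patterns that
  meet \<open>W\<close> accessible.
\<close>

definition symm_hits :: "'a set \<Rightarrow> ('a \<times> 'a) set \<Rightarrow> ('a \<Rightarrow> 'a) \<Rightarrow> real" where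
  "symm_hits W K \<tau> = (\<Sum>u | u permutes W. \<Sum>v | v permutes W. hits K (u \<circ> \<tau> \<circ> v))"

lemma sandwich_permutes:
  assumes "W \<subseteq> A" "\<tau> permutes A" "u permutes W" "v permutes W"
  shows "u \<circ> \<tau> \<circ> v permutes A"
proof -
  have "u permutes A" "v permutes A" using assms permutes_subset by blast+
  then show ?thesis
    by (intro permutes_compose[OF _ permutes_compose[OF assms(2)]]) 
qed

lemma symm_hits_not_partial_inj:
  assumes "W \<subseteq> A" "\<tau> permutes A" "\<not> partial_inj K"
  shows "symm_hits W K \<tau> = 0"
  unfolding symm_hits_def
  using hits_eq_zero_if_not_partial_inj[OF permutes_inj[OF sandwich_permutes[OF assms(1,2)]] assms(3)]
  by (simp add: sum.neutral)

lemma symm_hits_swap: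
  assumes "W \<subseteq> A" "\<tau> permutes A"
  shows "symm_hits W (prod.swap ` K) (inv \<tau>) = symm_hits W K \<tau>"
proof -
  have "symm_hits W (prod.swap ` K) (inv \<tau>)
    = (\<Sum>u | u permutes W. \<Sum>v | v permutes W. hits (prod.swap ` K) (inv u \<circ> inv \<tau> \<circ> inv v))"
    unfolding symm_hits_def
    by (subst sum_permutations_inverse, subst (2) sum_permutations_inverse) simp
  also have "\<dots> = (\<Sum>u | u permutes W. \<Sum>v | v permutes W. hits K (v \<circ> \<tau> \<circ> u))"
  proof (intro sum.cong refl)
    fix u v assume "u \<in> {u. u permutes W}" "v \<in> {v. v permutes W}"
    then have bij: "bij u" "bij v" "bij \<tau>" "bij (v \<circ> \<tau> \<circ> u)"
      using assms(2) permutes_bij sandwich_permutes[OF assms, of v u] by auto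
    then have "inv u \<circ> inv \<tau> \<circ> inv v = inv (v \<circ> \<tau> \<circ> u)"
      by (simp add: o_inv_distrib bij_comp comp_assoc)
    then show "hits (prod.swap ` K) (inv u \<circ> inv \<tau> \<circ> inv v) = hits K (v \<circ> \<tau> \<circ> u)"
      using hits_inv[OF bij(4), of "prod.swap ` K"] by (simp add: image_image)
  qed
  also have "\<dots> = symm_hits W K \<tau>"
    unfolding symm_hits_def by (rule sum.swap)
  finally show ?thesis .
qed

lemma symm_hits_sum_over_value:
  assumes "finite A" "W \<subseteq> A" "\<tau> permutes A" "a \<in> A"
  shows "(\<Sum>y\<in>A. symm_hits W (insert (a, y) K) \<tau>) = symm_hits W K \<tau>"
proof -
  have "(\<Sum>y\<in>A. symm_hits W (insert (a, y) K) \<tau>)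
    = (\<Sum>u | u permutes W. \<Sum>v | v permutes W. \<Sum>y\<in>A. hits (insert (a, y) K) (u \<circ> \<tau> \<circ> v))"
    unfolding symm_hits_def by (subst sum.swap, intro sum.cong refl, rule sum.swap)
  also have "\<dots> = symm_hits W K \<tau>"
    unfolding symm_hits_def
    using sum_hits_over_value[OF assms(1) sandwich_permutes[OF assms(2,3)] assms(4)]
    by (intro sum.cong refl) auto
  finally show ?thesis .
qed

lemma symm_hits_transpose:
  assumes "b \<in> W" "y \<in> W" "b \<notin> snd ` K" "y \<notin> snd ` K"
  shows "symm_hits W (insert (a, y) K) \<tau> = symm_hits W (insert (a, b) K) \<tau>"
proof -
  let ?g = "transpose b y"
  have "hits (insert (a, y) K) \<pi> = hits (insert (a, b) K) (?g \<circ> \<pi>)" for \<pi>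
    using hits_comp_left[of ?g "insert (a, b) K" \<pi>] transpose_fixes_pattern[OF assms(3,4)] by simp
  then show ?thesis
    unfolding symm_hits_def
    using setum_permutations_compose_left[OF permutes_swap_id[OF assms(1,2)],
        of "\<lambda>u. \<Sum>v | v permutes W. hits (insert (a, b) K) (u \<circ> \<tau> \<circ> v)"]
    by (simp add: comp_assoc)
qed

text \<open>
  Summing over all values at \<open>a\<close> forgets the condition at \<open>a\<close>. The values in the buffer all contribute
  equally by symmetry, so one such value can be expressed by the values outside and the shorter
  pattern.
\<close>

lemma symm_hits_eliminate:
  assumes A: "finite A" "W \<subseteq> A" and \<tau>: "\<tau> permutes A"
    and a: "a \<in> A" "a \<notin> fst ` K" and b: "b \<in> W" "b \<notin> snd ` K"
  shows "real (card (W - snd ` K)) * symm_hits W (insert (a, b) K) \<tau>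
    = symm_hits W K \<tau> - (\<Sum>y\<in>A - W. symm_hits W (insert (a, y) K) \<tau>)"
proof -
  have "symm_hits W K \<tau> = (\<Sum>y\<in>A - W. symm_hits W (insert (a, y) K) \<tau>)
      + (\<Sum>y\<in>W. symm_hits W (insert (a, y) K) \<tau>)"
    using symm_hits_sum_over_value[OF A \<tau> a(1), of K]
      sum.subset_diff[OF A(2,1), of "\<lambda>y. symm_hits W (insert (a, y) K) \<tau>"] by simp
  also have "(\<Sum>y\<in>W. symm_hits W (insert (a, y) K) \<tau>)
      = (\<Sum>y\<in>W - snd ` K. symm_hits W (insert (a, b) K) \<tau>)"
  proof (intro sum.mono_neutral_cong_right ballI)
    show "finite W" using A finite_subset by blast
    show "symm_hits W (insert (a, y) K) \<tau> = 0" if "y \<in> W - (W - snd ` K)" for y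
      using that symm_hits_not_partial_inj[OF A(2) \<tau> not_partial_inj_insert[OF a(2)]] by simp
    show "symm_hits W (insert (a, y) K) \<tau> = symm_hits W (insert (a, b) K) \<tau>"
      if "y \<in> W - snd ` K" for y
      using that b by (intro symm_hits_transpose) auto
  qed auto
  finally show ?thesis by simp
qed

lemma symm_hits_off_buffer:
  assumes "K \<subseteq> (- W) \<times> (- W)"
  shows "symm_hits W K \<tau> = (real (card {u. u permutes W}))\<^sup>2 * hits K \<tau>"
proof -
  have "hits K (u \<circ> \<tau> \<circ> v) = hits K \<tau>" if u: "u permutes W" and v: "v permutes W" for u v
  proof -
    have "(u \<circ> \<tau> \<circ> v) a = b \<longleftrightarrow> \<tau> a = b" if "(a, b) \<in> K" for a b
    proof -
      have "a \<notin> W" "b \<notin> W" using that assms by auto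
      then show ?thesis
        using permutes_not_in[OF v, of a] permutes_in_image[OF u, of "\<tau> a"]
          permutes_not_in[OF u, of "\<tau> a"] by (metis comp_apply)
    qed
    then show ?thesis
      unfolding hits_def by (intro arg_cong[where f = of_bool] ball_cong refl) auto
  qed
  then show ?thesis
    by (simp add: symm_hits_def power2_eq_square)
qed

lemma symm_hits_identity_step:
  assumes A: "finite A" "W \<subseteq> A" and \<tau>: "\<And>j. j \<in> J \<Longrightarrow> \<tau> j permutes A"
    and \<pi>: "\<pi> permutes A"
    and ab: "a \<in> A" "a \<notin> fst ` K" "b \<in> W" "b \<notin> snd ` K"
    and K: "(\<Sum>j\<in>J. c j * symm_hits W K (\<tau> j)) = symm_hits W K \<pi>"
    and y: "\<And>y. y \<in> A - W \<Longrightarrow>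
      (\<Sum>j\<in>J. c j * symm_hits W (insert (a, y) K) (\<tau> j)) = symm_hits W (insert (a, y) K) \<pi>"
  shows "(\<Sum>j\<in>J. c j * symm_hits W (insert (a, b) K) (\<tau> j)) = symm_hits W (insert (a, b) K) \<pi>"
proof -
  let ?r = "real (card (W - snd ` K))"
  have "finite W" using A finite_subset by blast
  then have r: "?r \<noteq> 0" using ab by auto
  have "?r * (\<Sum>j\<in>J. c j * symm_hits W (insert (a, b) K) (\<tau> j))
    = (\<Sum>j\<in>J. c j * (?r * symm_hits W (insert (a, b) K) (\<tau> j)))"
    by (simp add: sum_distrib_left mult_ac)
  also have "\<dots> = (\<Sum>j\<in>J. c j * symm_hits W K (\<tau> j)
      - (\<Sum>y\<in>A - W. c j * symm_hits W (insert (a, y) K) (\<tau> j)))"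
    by (intro sum.cong refl) (simp only: symm_hits_eliminate[OF A \<tau> ab] right_diff_distrib sum_distrib_left)
  also have "\<dots> = (\<Sum>j\<in>J. c j * symm_hits W K (\<tau> j))
      - (\<Sum>y\<in>A - W. \<Sum>j\<in>J. c j * symm_hits W (insert (a, y) K) (\<tau> j))"
    unfolding sum_subtractf by (rule arg_cong[where f = "(-) _"], rule sum.swap)
  also have "\<dots> = ?r * symm_hits W (insert (a, b) K) \<pi>"
    using symm_hits_eliminate[OF A \<pi> ab] K y by simp
  finally show ?thesis using r by simp
qed

text \<open>
  The elimination above is a linear relation valid for all permutations alike, so by induction on the
  number of entries in \<open>W\<close> a linear identity that holds for patterns avoiding \<open>W\<close> holds for the
  symmetrised versions of all patterns of the same order.
\<close>

lemma symm_hits_identity: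
  assumes A: "finite A" "W \<subseteq> A" and \<tau>: "\<And>j. j \<in> J \<Longrightarrow> \<tau> j permutes A"
    and \<pi>: "\<pi> permutes A"
    and off: "\<And>L. L \<in> patterns (A - W) t \<Longrightarrow> (\<Sum>j\<in>J. c j * hits L (\<tau> j)) = hits L \<pi>"
    and K: "K \<in> patterns A t"
  shows "(\<Sum>j\<in>J. c j * symm_hits W K (\<tau> j)) = symm_hits W K \<pi>"
  using K
proof (induction "card {p \<in> K. fst p \<in> W} + card {p \<in> K. snd p \<in> W}" arbitrary: K rule: less_induct)
  case less
  note K = patternsD[OF less.prems A(1)]
  define m where "m K = card {p \<in> K. fst p \<in> W} + card {p \<in> K. snd p \<in> W}" for K :: "('a \<times> 'a) set"
  have IH: "(\<Sum>j\<in>J. c j * symm_hits W L (\<tau> j)) = symm_hits W L \<pi>"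
    if "m L < m K" "L \<in> patterns A t" for L
    using less.hyps that unfolding m_def by blast
  have m_insert: "m (insert p L) = m L + of_bool (fst p \<in> W) + of_bool (snd p \<in> W)"
    if "finite L" "p \<notin> L" for p L
  proof -
    have "{q \<in> insert p L. f q \<in> W} = (if f p \<in> W then insert p {q \<in> L. f q \<in> W} else {q \<in> L. f q \<in> W})"
      for f :: "'a \<times> 'a \<Rightarrow> 'a" by auto
    then show ?thesis using that by (simp add: m_def)
  qed
  consider "\<not> partial_inj K" | "K \<subseteq> (- W) \<times> (- W)"
    | a b where "partial_inj K" "(a, b) \<in> K" "b \<in> W"
    | a b where "partial_inj K" "(a, b) \<in> K" "a \<in> W"
    by (metis subrelI SigmaI ComplI)
  then show ?case
  proof cases
    case 1
    then show ?thesis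
      using symm_hits_not_partial_inj[OF A(2) _ 1] \<tau> \<pi> by simp
  next
    case 2
    then have "K \<in> patterns (A - W) t" using K by (auto simp: patterns_def)
    then show ?thesis
      by (simp add: symm_hits_off_buffer[OF 2] mult.left_commute[of "c _"] off[symmetric] sum_distrib_left)
  next
    case 3
    define K0 where "K0 = K - {(a, b)}"
    have K0: "K = insert (a, b) K0" "(a, b) \<notin> K0" "finite K0" using 3 K by (auto simp: K0_def)
    have new: "a \<notin> fst ` K0" "b \<notin> snd ` K0"
      using partial_inj_insertD[of a b K0] 3 K0 by auto
    have ab: "a \<in> A" "b \<in> A" "K0 \<subseteq> A \<times> A" "Suc (card K0) \<le> t" using K K0 by auto
    have mK: "m K0 + of_bool (a \<in> W) < m K"
      using m_insert[OF K0(3,2)] 3(3) K0(1) by simp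
    show ?thesis
      unfolding K0(1)
    proof (rule symm_hits_identity_step[OF A \<tau> \<pi> ab(1) new(1) 3(3) new(2)])
      show "(\<Sum>j\<in>J. c j * symm_hits W K0 (\<tau> j)) = symm_hits W K0 \<pi>"
        using mK ab by (intro IH) (auto simp: patterns_def)
      fix y assume y: "y \<in> A - W"
      have "(a, y) \<notin> K0" using new(1) by force
      then show "(\<Sum>j\<in>J. c j * symm_hits W (insert (a, y) K0) (\<tau> j)) = symm_hits W (insert (a, y) K0) \<pi>"
        using mK ab y m_insert[OF K0(3), of "(a, y)"] K0(3)
        by (intro IH) (auto simp: patterns_def)
    qed
  next
    case 4
    \<comment> \<open>Inverting all permutations exchanges points and values and reduces this to the previous case.\<close>
    define K0 where "K0 = K - {(a, b)}"
    have K0: "K = insert (a, b) K0" "(a, b) \<notin> K0" "finite K0" using 4 K by (auto simp: K0_def)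
    have new: "a \<notin> fst ` K0" "b \<notin> snd ` K0"
      using partial_inj_insertD[of a b K0] 4 K0 by auto
    have ab: "a \<in> A" "b \<in> A" "K0 \<subseteq> A \<times> A" "Suc (card K0) \<le> t" using K K0 by auto
    have mK: "m K0 + of_bool (b \<in> W) < m K"
      using m_insert[OF K0(3,2)] 4(3) K0(1) by simp
    have flip: "(\<Sum>j\<in>J. c j * symm_hits W (prod.swap ` L) (inv (\<tau> j))) = symm_hits W (prod.swap ` L) (inv \<pi>)
      \<longleftrightarrow> (\<Sum>j\<in>J. c j * symm_hits W L (\<tau> j)) = symm_hits W L \<pi>" for L
      using symm_hits_swap[OF A(2) \<tau>, of _ L] symm_hits_swap[OF A(2) \<pi>, of L] by simp
    have swap_insert: "insert (b, x) (prod.swap ` K0) = prod.swap ` insert (x, b) K0" for x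
      by simp
    have "(\<Sum>j\<in>J. c j * symm_hits W (insert (b, a) (prod.swap ` K0)) (inv (\<tau> j)))
      = symm_hits W (insert (b, a) (prod.swap ` K0)) (inv \<pi>)"
    proof (rule symm_hits_identity_step[OF A _ permutes_inv[OF \<pi>] ab(2) _ 4(3)])
      show "inv (\<tau> j) permutes A" if "j \<in> J" for j using \<tau>[OF that] permutes_inv by blast
      show "b \<notin> fst ` prod.swap ` K0" "a \<notin> snd ` prod.swap ` K0"
        using new by (auto simp: image_image)
      show "(\<Sum>j\<in>J. c j * symm_hits W (prod.swap ` K0) (inv (\<tau> j))) = symm_hits W (prod.swap ` K0) (inv \<pi>)"
        unfolding flip using mK ab by (intro IH) (auto simp: patterns_def)
      fix x assume x: "x \<in> A - W"
      have "(x, b) \<notin> K0" using new(2) by force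
      then show "(\<Sum>j\<in>J. c j * symm_hits W (insert (b, x) (prod.swap ` K0)) (inv (\<tau> j)))
          = symm_hits W (insert (b, x) (prod.swap ` K0)) (inv \<pi>)"
        unfolding swap_insert flip
        using mK ab x m_insert[OF K0(3), of "(x, b)"] K0(3)
        by (intro IH) (auto simp: patterns_def)
    qed
    then show ?thesis
      unfolding swap_insert flip K0(1) .
  qed
qed

section \<open>Reconstructing a permutation from boundedly supported ones\<close>

lemma card_bounded_subsets_le:
  assumes "finite A"
  shows "card {V. V \<subseteq> A \<and> card V \<le> k} \<le> (card A + 1) ^ k"
proof -
  define X where "X = {xs. set xs \<subseteq> insert None (Some ` A) \<and> length xs = k}"
  have fin: "finite (insert None (Some ` A))" using assms by simp
  have card_X: "card X = (card A + 1) ^ k"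
    unfolding X_def using assms by (simp add: card_lists_length_eq card_image)
  have "{V. V \<subseteq> A \<and> card V \<le> k} \<subseteq> (\<lambda>xs. {a. Some a \<in> set xs}) ` X"
  proof
    fix V assume V: "V \<in> {V. V \<subseteq> A \<and> card V \<le> k}"
    then have "finite V" using assms finite_subset by blast
    then obtain ys where ys: "set ys = V" "distinct ys" using finite_distinct_list by blast
    define xs where "xs = map Some ys @ replicate (k - length ys) None"
    have "length ys \<le> k" using V ys distinct_card by fastforce
    then have "xs \<in> X" using V ys by (auto simp: X_def xs_def)
    moreover have "V = {a. Some a \<in> set xs}" using ys by (auto simp: xs_def)
    ultimately show "V \<in> (\<lambda>xs. {a. Some a \<in> set xs}) ` X" by blast
  qed
  moreover have "finite X" unfolding X_def using fin by (rule finite_lists_length_eq)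
  ultimately show ?thesis
    using card_X by (metis (no_types, lifting) surj_card_le)
qed

lemma card_patterns_le:
  assumes "finite A"
  shows "card (patterns A k) \<le> ((card A)\<^sup>2 + 1) ^ k"
  using card_bounded_subsets_le[of "A \<times> A" k] assms
  by (simp add: patterns_def card_cartesian_product power2_eq_square)

lemma sum_swap_pairs:
  fixes f :: "'a \<Rightarrow> 'b \<Rightarrow> 'c \<Rightarrow> 'd \<Rightarrow> real"
  shows "(\<Sum>a\<in>A. \<Sum>b\<in>B. \<Sum>c\<in>C. \<Sum>d\<in>D. f a b c d) = (\<Sum>c\<in>C. \<Sum>d\<in>D. \<Sum>a\<in>A. \<Sum>b\<in>B. f a b c d)"
proof -
  have "(\<Sum>a\<in>A. \<Sum>b\<in>B. \<Sum>c\<in>C. \<Sum>d\<in>D. f a b c d)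
    = (\<Sum>p\<in>A \<times> B. \<Sum>q\<in>C \<times> D. f (fst p) (snd p) (fst q) (snd q))"
    by (simp add: sum.cartesian_product' case_prod_beta)
  also have "\<dots> = (\<Sum>q\<in>C \<times> D. \<Sum>p\<in>A \<times> B. f (fst p) (snd p) (fst q) (snd q))"
    by (rule sum.swap)
  also have "\<dots> = (\<Sum>c\<in>C. \<Sum>d\<in>D. \<Sum>a\<in>A. \<Sum>b\<in>B. f a b c d)"
    by (simp add: sum.cartesian_product' case_prod_beta)
  finally show ?thesis .
qed

text \<open>
  There is one buffer more than a pattern of order \<open>t\<close> can meet, and each can serve for surgeries on
  up to \<open>2 t\<close> points.
\<close>

locale buffers =
  fixes A :: "'a set" and W :: "nat \<Rightarrow> 'a set" and t :: nat
  assumes finite_A: "finite A"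
    and W_sub: "\<And>j. j \<le> 2 * t \<Longrightarrow> W j \<subseteq> A"
    and W_disjoint: "disjoint_family_on W {..2 * t}"
    and W_large: "\<And>j. j \<le> 2 * t \<Longrightarrow> 2 * t \<le> card (W j)"
begin

text \<open>
  A shuffler is a simultaneous choice of one permutation for each buffer, and a mask keeps the choices
  for the buffers in \<open>S\<close> only. Summing over shufflers with mask \<open>S\<close> on both sides is averaging over
  the buffers in \<open>S\<close>, but with the same number of terms for every \<open>S\<close>, hence with one common
  denominator.
\<close>

definition shufflers :: "('a \<Rightarrow> 'a) set" where
  "shufflers = {g. g permutes (\<Union>j\<le>2 * t. W j) \<and> (\<forall>j\<le>2 * t. g ` W j = W j)}"

definition mask :: "nat set \<Rightarrow> ('a \<Rightarrow> 'a) \<Rightarrow> 'a \<Rightarrow> 'a" where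
  "mask S g = restrict_id g (\<Union>j\<in>S. W j)"

definition shuffled_hits :: "nat set \<Rightarrow> ('a \<times> 'a) set \<Rightarrow> ('a \<Rightarrow> 'a) \<Rightarrow> real" where
  "shuffled_hits S L \<tau> = (\<Sum>g\<in>shufflers. \<Sum>h\<in>shufflers. hits L (mask S g \<circ> \<tau> \<circ> mask S h))"

lemma finite_shufflers: "finite shufflers"
  and card_shufflers_le: "card shufflers \<le> fact (card (\<Union>j\<le>2 * t. W j))"
proof -
  have fin: "finite (\<Union>j\<le>2 * t. W j)"
    using W_sub finite_A finite_subset by blast
  have sub: "shufflers \<subseteq> {g. g permutes (\<Union>j\<le>2 * t. W j)}" by (auto simp: shufflers_def)
  then show "finite shufflers" using finite_permutations[OF fin] finite_subset by blast
  show "card shufflers \<le> fact (card (\<Union>j\<le>2 * t. W j))"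
    using card_mono[OF finite_permutations[OF fin] sub] card_permutations[OF refl fin] by simp
qed

lemma id_in_shufflers: "id \<in> shufflers"
  by (simp add: shufflers_def)

lemma mask_permutes:
  assumes "g \<in> shufflers" "S \<subseteq> {..2 * t}"
  shows "mask S g permutes A"
proof -
  have "g ` (\<Union>j\<in>S. W j) = (\<Union>j\<in>S. W j)"
    using assms by (auto simp: shufflers_def image_UN subset_iff)
  moreover have "inj g" using assms(1) permutes_inj by (auto simp: shufflers_def)
  ultimately have "bij_betw g (\<Union>j\<in>S. W j) (\<Union>j\<in>S. W j)"
    by (auto simp: bij_betw_def intro: inj_on_subset)
  then have "mask S g permutes (\<Union>j\<in>S. W j)"
    unfolding mask_def by (rule permutes_restrict_id)
  moreover have "(\<Union>j\<in>S. W j) \<subseteq> A" using W_sub assms(2) by fastforce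
  ultimately show ?thesis by (rule permutes_subset)
qed

lemma mask_empty [simp]: "mask {} g = id"
  by (auto simp: mask_def restrict_id_def fun_eq_iff)

lemma permutes_in_shufflers:
  assumes "u permutes W i" "i \<le> 2 * t"
  shows "u \<in> shufflers"
proof -
  have "u ` W j = W j" if "j \<le> 2 * t" for j
  proof (cases "j = i")
    case True
    then show ?thesis using permutes_image[OF assms(1)] by simp
  next
    case False
    then have "W j \<inter> W i = {}" using W_disjoint that assms(2) by (auto simp: disjoint_family_on_def)
    then have "u x = x" if "x \<in> W j" for x
      using permutes_not_in[OF assms(1), of x] that by auto
    then show ?thesis by simp
  qed
  moreover have "u permutes (\<Union>j\<le>2 * t. W j)"
    using permutes_subset[OF assms(1), of "\<Union>j\<le>2 * t. W j"] assms(2) by blast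
  ultimately show ?thesis by (simp add: shufflers_def)
qed

lemma shufflers_comp: "g \<in> shufflers \<Longrightarrow> h \<in> shufflers \<Longrightarrow> g \<circ> h \<in> shufflers"
  unfolding shufflers_def using permutes_compose[of h _ g] by (simp only: mem_Collect_eq image_comp[symmetric]) simp

lemma shufflers_comp_bij:
  assumes "u permutes W i" "i \<le> 2 * t"
  shows "bij_betw (\<lambda>g. g \<circ> u) shufflers shufflers" "bij_betw (\<lambda>g. u \<circ> g) shufflers shufflers"
proof -
  have u: "u \<in> shufflers" "inv u \<in> shufflers"
    using permutes_in_shufflers assms permutes_inv by blast+
  have "u \<circ> inv u = id" "inv u \<circ> u = id"
    using permutes_inv_o[OF assms(1)] by auto
  then have c: "g \<circ> u \<circ> inv u = g" "g \<circ> inv u \<circ> u = g" "u \<circ> (inv u \<circ> g) = g" "inv u \<circ> (u \<circ> g) = g" for g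
    by (metis comp_assoc comp_id id_comp)+
  show "bij_betw (\<lambda>g. g \<circ> u) shufflers shufflers"
    by (rule bij_betw_byWitness[where f' = "\<lambda>g. g \<circ> inv u"])
      (use u c shufflers_comp in auto)
  show "bij_betw (\<lambda>g. u \<circ> g) shufflers shufflers"
    by (rule bij_betw_byWitness[where f' = "\<lambda>g. inv u \<circ> g"])
      (use u c shufflers_comp in auto)
qed

lemma mask_comp:
  assumes "u permutes W i" "i \<in> S"
  shows "mask S (g \<circ> u) = mask S g \<circ> u" "mask S (u \<circ> g) = u \<circ> mask S g"
proof -
  have "u x \<in> (\<Union>j\<in>S. W j)" if "x \<in> (\<Union>j\<in>S. W j)" for x
    using that permutes_in_image[OF assms(1), of x] permutes_not_in[OF assms(1), of x] assms(2)
    by (cases "x \<in> W i") auto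
  moreover have "u x = x" if "x \<notin> (\<Union>j\<in>S. W j)" for x
    using permutes_not_in[OF assms(1), of x] that assms(2) by auto
  ultimately show "mask S (g \<circ> u) = mask S g \<circ> u" "mask S (u \<circ> g) = u \<circ> mask S g"
    by (auto simp: mask_def restrict_id_def fun_eq_iff)
qed

lemma untouched_buffer:
  assumes "L \<in> patterns A t"
  obtains j where "j \<le> 2 * t" "W j \<inter> (fst ` L \<union> snd ` L) = {}"
proof (rule ccontr)
  assume "\<not> thesis"
  then have "\<forall>j\<in>{..2 * t}. \<exists>x. x \<in> W j \<inter> (fst ` L \<union> snd ` L)" using that by fastforce
  then obtain f where f: "\<And>j. j \<in> {..2 * t} \<Longrightarrow> f j \<in> W j \<inter> (fst ` L \<union> snd ` L)" by metis
  have "inj_on f {..2 * t}"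
  proof (rule inj_onI, rule ccontr)
    fix i j assume ij: "i \<in> {..2 * t}" "j \<in> {..2 * t}" "f i = f j" "i \<noteq> j"
    then have "W i \<inter> W j = {}" using W_disjoint by (auto simp: disjoint_family_on_def)
    then show False using f[of i] f[of j] ij by auto
  qed
  then have "card {..2 * t} \<le> card (fst ` L \<union> snd ` L)"
    using f patternsD(1)[OF assms finite_A] by (intro card_inj_on_le[of f]) auto
  also have "\<dots> \<le> card (fst ` L) + card (snd ` L)" by (rule card_Un_le)
  also have "\<dots> \<le> 2 * t"
    using patternsD[OF assms finite_A] card_image_le[of L fst] card_image_le[of L snd] by linarith
  finally show False by simp
qed

text \<open>
  The pattern misses some buffer \<open>W j\<close>, and then whether \<open>j\<close> belongs to \<open>S\<close> makes no difference.
  The sum vanishes for each single choice of \<open>g\<close> and \<open>h\<close>, even before averaging over them.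
\<close>

lemma alternating_masks_vanish:
  assumes L: "L \<in> patterns A t" and g: "g \<in> shufflers"
  shows "(\<Sum>S\<in>Pow {..2 * t}. (-1) ^ card S * hits L (mask S g \<circ> \<pi> \<circ> mask S h)) = 0"
proof -
  obtain j where j: "j \<le> 2 * t" "W j \<inter> (fst ` L \<union> snd ` L) = {}"
    using untouched_buffer[OF L] .
  show ?thesis
  proof (rule alternating_sum_toggle[of _ j])
    fix T assume T: "T \<subseteq> {..2 * t} - {j}"
    have "(mask (insert j T) g \<circ> \<pi> \<circ> mask (insert j T) h) a = b \<longleftrightarrow>
        (mask T g \<circ> \<pi> \<circ> mask T h) a = b" if "(a, b) \<in> L" for a b
    proof -
      have ab: "a \<notin> W j" "b \<notin> W j" using j(2) that by force+
      have off: "mask (insert j T) f x = mask T f x" if "x \<notin> W j" for f x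
        using that by (simp add: mask_def restrict_id_def)
      define y where "y = \<pi> (mask T h a)"
      have "mask (insert j T) g y = b \<longleftrightarrow> mask T g y = b"
      proof (cases "y \<in> W j")
        case True
        have "W k \<inter> W j = {}" if "k \<in> T" for k
          using W_disjoint that T j(1) unfolding disjoint_family_on_def by blast
        then have "y \<notin> (\<Union>k\<in>T. W k)" using True by blast
        then have "mask T g y = y" "mask (insert j T) g y = g y"
          using True by (auto simp: mask_def restrict_id_def)
        moreover have "g y \<in> W j" using g True j(1) by (auto simp: shufflers_def)
        ultimately show ?thesis using True ab(2) by auto
      qed (simp add: off)
      then show ?thesis using off[OF ab(1), of h] by (simp add: y_def)
    qed
    then show "hits L (mask (insert j T) g \<circ> \<pi> \<circ> mask (insert j T) h)
        = hits L (mask T g \<circ> \<pi> \<circ> mask T h)"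
      unfolding hits_def by (intro arg_cong[where f = of_bool] ball_cong refl) auto
  qed (use j in auto)
qed

text \<open>
  The shufflers are invariant under composition with permutations of \<open>W i\<close>, so a symmetrisation over
  \<open>W i\<close> may be inserted directly around \<open>\<tau>\<close> at no cost, provided that \<open>i \<in> S\<close>.
\<close>

lemma shuffled_hits_symm:
  assumes S: "S \<subseteq> {..2 * t}" "i \<in> S" and L: "L \<in> patterns A t"
  shows "(real (card {u. u permutes W i}))\<^sup>2 * shuffled_hits S L \<tau>
    = (\<Sum>g\<in>shufflers. \<Sum>h\<in>shufflers.
        symm_hits (W i) (map_prod (mask S h) (inv (mask S g)) ` L) \<tau>)"
proof -
  let ?U = "{u. u permutes W i}"
  have i: "i \<le> 2 * t" using S by auto
  have "(real (card ?U))\<^sup>2 * shuffled_hits S L \<tau> = (\<Sum>u\<in>?U. \<Sum>v\<in>?U. shuffled_hits S L \<tau>)"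
    by (simp add: power2_eq_square)
  also have "\<dots> = (\<Sum>u\<in>?U. \<Sum>v\<in>?U. \<Sum>g\<in>shufflers. \<Sum>h\<in>shufflers.
      hits L (mask S g \<circ> (u \<circ> \<tau> \<circ> v) \<circ> mask S h))"
  proof (intro sum.cong refl)
    fix u v assume uv: "u \<in> ?U" "v \<in> ?U"
    then have u: "u permutes W i" and v: "v permutes W i" by auto
    have "shuffled_hits S L \<tau> = (\<Sum>g\<in>shufflers. \<Sum>h\<in>shufflers.
        hits L (mask S (g \<circ> u) \<circ> \<tau> \<circ> mask S h))"
      unfolding shuffled_hits_def
      by (rule sum.reindex_bij_betw[OF shufflers_comp_bij(1)[OF u i], symmetric])
    also have "\<dots> = (\<Sum>g\<in>shufflers. \<Sum>h\<in>shufflers.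
        hits L (mask S (g \<circ> u) \<circ> \<tau> \<circ> mask S (v \<circ> h)))"
    proof (rule sum.cong[OF refl])
      fix g
      show "(\<Sum>h\<in>shufflers. hits L (mask S (g \<circ> u) \<circ> \<tau> \<circ> mask S h))
        = (\<Sum>h\<in>shufflers. hits L (mask S (g \<circ> u) \<circ> \<tau> \<circ> mask S (v \<circ> h)))"
        by (rule sum.reindex_bij_betw[OF shufflers_comp_bij(2)[OF v i], symmetric])
    qed
    finally have "shuffled_hits S L \<tau> = (\<Sum>g\<in>shufflers. \<Sum>h\<in>shufflers.
        hits L (mask S (g \<circ> u) \<circ> \<tau> \<circ> mask S (v \<circ> h)))" .
    then show "shuffled_hits S L \<tau> = (\<Sum>g\<in>shufflers. \<Sum>h\<in>shufflers.
        hits L (mask S g \<circ> (u \<circ> \<tau> \<circ> v) \<circ> mask S h))"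
      unfolding mask_comp(1)[OF u S(2)] mask_comp(2)[OF v S(2)] by (simp only: comp_assoc)
  qed
  also have "\<dots> = (\<Sum>g\<in>shufflers. \<Sum>h\<in>shufflers. \<Sum>u\<in>?U. \<Sum>v\<in>?U.
      hits L (mask S g \<circ> (u \<circ> \<tau> \<circ> v) \<circ> mask S h))"
    by (rule sum_swap_pairs)
  also have "\<dots> = (\<Sum>g\<in>shufflers. \<Sum>h\<in>shufflers.
        symm_hits (W i) (map_prod (mask S h) (inv (mask S g)) ` L) \<tau>)"
    unfolding symm_hits_def
  proof (intro sum.cong refl)
    fix g h u v assume g: "g \<in> shufflers"
    have "hits L (mask S g \<circ> \<rho> \<circ> mask S h)
        = hits (map_prod (mask S h) (inv (mask S g)) ` L) \<rho>" for \<rho>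
      using hits_comp_left[OF permutes_bij[OF mask_permutes[OF g S(1)]], of L "\<rho> \<circ> mask S h"]
        hits_comp_right[of "map_prod id (inv (mask S g)) ` L" \<rho> "mask S h"]
      by (simp add: comp_assoc image_image map_prod_def case_prod_beta)
    then show "hits L (mask S g \<circ> (u \<circ> \<tau> \<circ> v) \<circ> mask S h)
        = hits (map_prod (mask S h) (inv (mask S g)) ` L) (u \<circ> \<tau> \<circ> v)" .
  qed
  finally show ?thesis .
qed

lemma shuffled_hits_surgery:
  assumes S: "S \<subseteq> {..2 * t}" "i \<in> S" and L: "L \<in> patterns A t" and \<pi>: "\<pi> permutes A"
  shows "(\<Sum>V | V \<subseteq> A - W i \<and> card V \<le> 2 * t. \<Sum>T\<in>Pow V.
      (-1) ^ (card V + card T) * shuffled_hits S L (surgery A (W i) (graph_on \<pi> T)))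
    = shuffled_hits S L \<pi>"
proof -
  have i: "i \<le> 2 * t" using S by auto
  define VV where "VV = {V. V \<subseteq> A - W i \<and> card V \<le> 2 * t}"
  define J where "J = Sigma VV Pow"
  define c :: "'a set \<times> 'a set \<Rightarrow> real" where "c = (\<lambda>(V, T). (-1) ^ (card V + card T))"
  define \<tau> where "\<tau> = (\<lambda>(V :: 'a set, T). surgery A (W i) (graph_on \<pi> T))"
  have finVV: "finite VV"
    using finite_A by (auto simp: VV_def intro: finite_subset[of _ "Pow A"])
  have finV: "finite V" if "V \<in> VV" for V
    using that finite_A finite_subset by (auto simp: VV_def)
  have flat: "(\<Sum>V\<in>VV. \<Sum>T\<in>Pow V. (-1) ^ (card V + card T) * F (surgery A (W i) (graph_on \<pi> T)))
    = (\<Sum>j\<in>J. c j * F (\<tau> j))" for F :: "('a \<Rightarrow> 'a) \<Rightarrow> real"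
    unfolding J_def c_def \<tau>_def using finVV finV
    by (subst sum.Sigma) (auto simp: case_prod_beta)
  have \<tau>: "\<tau> j permutes A" if j: "j \<in> J" for j
  proof -
    obtain V T where VT: "j = (V, T)" "V \<in> VV" "T \<subseteq> V" using j by (auto simp: J_def)
    have "card T \<le> card (W i)"
      using card_mono[OF finV[OF VT(2)] VT(3)] VT(2) W_large[OF i] by (auto simp: VV_def)
    then show ?thesis
      using surgery_graph(1)[OF finite_A W_sub[OF i] \<pi>, of T] VT by (auto simp: \<tau>_def VV_def)
  qed
  have off: "(\<Sum>j\<in>J. c j * hits K (\<tau> j)) = hits K \<pi>" if "K \<in> patterns (A - W i) t" for K
    using interpolation_off_buffer[OF finite_A W_sub[OF i] W_large[OF i] \<pi> that]
    unfolding flat[symmetric] VV_def .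
  define w where "w = (real (card {u. u permutes W i}))\<^sup>2"
  have "finite (W i)" using W_sub[OF i] finite_A finite_subset by blast
  then have "w \<noteq> 0" using card_permutations[of "W i", OF refl] by (simp add: w_def)
  have "w * (\<Sum>j\<in>J. c j * shuffled_hits S L (\<tau> j))
    = (\<Sum>j\<in>J. c j * (\<Sum>g\<in>shufflers. \<Sum>h\<in>shufflers.
        symm_hits (W i) (map_prod (mask S h) (inv (mask S g)) ` L) (\<tau> j)))"
    unfolding w_def shuffled_hits_symm[OF S L, symmetric] by (simp add: sum_distrib_left mult_ac)
  also have "\<dots> = (\<Sum>g\<in>shufflers. \<Sum>h\<in>shufflers. \<Sum>j\<in>J. c j *
        symm_hits (W i) (map_prod (mask S h) (inv (mask S g)) ` L) (\<tau> j))"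
    by (simp add: sum_distrib_left sum.swap[of _ J])
  also have "\<dots> = (\<Sum>g\<in>shufflers. \<Sum>h\<in>shufflers.
        symm_hits (W i) (map_prod (mask S h) (inv (mask S g)) ` L) \<pi>)"
  proof (intro sum.cong refl symm_hits_identity[OF finite_A W_sub[OF i] \<tau> \<pi> off])
    fix g h assume gh: "g \<in> shufflers" "h \<in> shufflers"
    show "map_prod (mask S h) (inv (mask S g)) ` L \<in> patterns A t"
      using permutes_image[OF mask_permutes[OF gh(2) S(1)]]
        permutes_image[OF permutes_inv[OF mask_permutes[OF gh(1) S(1)]]]
      by (intro map_prod_in_patterns[OF L finite_A]) auto
  qed
  also have "\<dots> = w * shuffled_hits S L \<pi>"
    unfolding w_def shuffled_hits_symm[OF S L] ..
  finally have "(\<Sum>j\<in>J. c j * shuffled_hits S L (\<tau> j)) = shuffled_hits S L \<pi>"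
    using \<open>w \<noteq> 0\<close> by simp
  then show ?thesis
    unfolding flat[symmetric] VV_def .
qed

text \<open>
  A site collects the summation indices of the final identity: the set \<open>S\<close> of active buffers, the set
  \<open>V\<close> of the Moebius inversion, the restriction \<open>K\<close> of \<open>\<pi>\<close> to a subset of \<open>V\<close>, and two shufflers.
  Of the active buffers, the one of least index is used for the surgery. Letting \<open>K\<close> range over all
  partial injections instead of the graphs of \<open>\<pi>\<close> makes the index set independent of \<open>\<pi>\<close>; the
  factor \<open>hits K \<pi>\<close> selects the right ones.
\<close>

type_synonym 'b site = "nat set \<times> 'b set \<times> ('b \<times> 'b) set \<times> ('b \<Rightarrow> 'b) \<times> ('b \<Rightarrow> 'b)"

definition sites :: "'a site set" where
  "sites = (SIGMA S:Pow {..2 * t} - {{}}. SIGMA V:{V. V \<subseteq> A - W (Min S) \<and> card V \<le> 2 * t}.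
     {K \<in> patterns A (2 * t). partial_inj K \<and> fst ` K \<subseteq> V} \<times> shufflers \<times> shufflers)"

definition site_sign :: "'a site \<Rightarrow> int" where
  "site_sign = (\<lambda>(S, V, K, g, h). - ((-1) ^ (card S + card V + card K)))"

definition site_pattern :: "'a site \<Rightarrow> ('a \<times> 'a) set" where
  "site_pattern = (\<lambda>(S, V, K, g, h). K)"

definition site_perm :: "'a site \<Rightarrow> 'a \<Rightarrow> 'a" where
  "site_perm = (\<lambda>(S, V, K, g, h). mask S g \<circ> surgery A (W (Min S)) K \<circ> mask S h)"

lemma sites_subset:
  "sites \<subseteq> Pow {..2 * t} \<times> {V. V \<subseteq> A \<and> card V \<le> 2 * t} \<times> patterns A (2 * t) \<times> shufflers \<times> shufflers"
  by (auto simp: sites_def)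

lemma finite_bounded_subsets: "finite {V. V \<subseteq> A \<and> card V \<le> k}"
  using finite_A by (auto intro: finite_subset[of _ "Pow A"])

lemma finite_sites: "finite sites"
  by (rule finite_subset[OF sites_subset])
    (simp add: finite_bounded_subsets finite_patterns finite_A finite_shufflers)

lemma card_sites_le:
  "card sites \<le> 2 ^ (2 * t + 1) * ((card A + 1) ^ (2 * t) * (((card A)\<^sup>2 + 1) ^ (2 * t) * (card shufflers)\<^sup>2))"
proof -
  have "card sites \<le> card (Pow {..2 * t} \<times> {V. V \<subseteq> A \<and> card V \<le> 2 * t} \<times> patterns A (2 * t) \<times> shufflers \<times> shufflers)"
    using sites_subset finite_bounded_subsets finite_patterns[OF finite_A] finite_shufflers
    by (intro card_mono finite_cartesian_product) auto
  also have "\<dots> = 2 ^ (2 * t + 1) * (card {V. V \<subseteq> A \<and> card V \<le> 2 * t} * (card (patterns A (2 * t)) * (card shufflers)\<^sup>2))"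
    by (simp add: card_cartesian_product card_Pow power2_eq_square)
  also have "\<dots> \<le> 2 ^ (2 * t + 1) * ((card A + 1) ^ (2 * t) * (((card A)\<^sup>2 + 1) ^ (2 * t) * (card shufflers)\<^sup>2))"
    using card_bounded_subsets_le[OF finite_A] card_patterns_le[OF finite_A]
    by (intro mult_le_mono) auto
  finally show ?thesis .
qed

lemma site_sign_abs: "\<bar>site_sign \<kappa>\<bar> = 1"
  by (simp add: site_sign_def case_prod_beta power_abs)

lemma site_pattern_in: "\<kappa> \<in> sites \<Longrightarrow> site_pattern \<kappa> \<in> patterns A (2 * t)"
  by (auto simp: sites_def site_pattern_def)

lemma site_perm_permutes:
  assumes "\<kappa> \<in> sites"
  shows "site_perm \<kappa> permutes A"
proof -
  obtain S V K g h where \<kappa>: "\<kappa> = (S, V, K, g, h)" by (cases \<kappa>)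
  have S: "S \<subseteq> {..2 * t}" "S \<noteq> {}" and V: "V \<subseteq> A - W (Min S)" "card V \<le> 2 * t"
    and K: "K \<in> patterns A (2 * t)" "partial_inj K" "fst ` K \<subseteq> V"
    and gh: "g \<in> shufflers" "h \<in> shufflers"
    using assms by (auto simp: \<kappa> sites_def)
  have "Min S \<in> S" using S finite_subset by (intro Min_in) auto
  then have i: "Min S \<le> 2 * t" using S by auto
  note K' = patternsD[OF K(1) finite_A]
  have "surgery_spec A (W (Min S)) K (surgery A (W (Min S)) K)"
    using K V K'(2,3) W_large[OF i] by (intro surgery[OF finite_A W_sub[OF i]]) auto
  then have "surgery A (W (Min S)) K permutes A" by (simp add: surgery_spec_def)
  then show ?thesis
    unfolding site_perm_def \<kappa>
    using mask_permutes[OF gh(1) S(1)] mask_permutes[OF gh(2) S(1)]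
    by (auto intro: permutes_compose)
qed

lemma sum_over_graphs:
  assumes V: "V \<subseteq> A" "card V \<le> k" and \<pi>: "\<pi> permutes A"
  shows "(\<Sum>T\<in>Pow V. F (card T) (graph_on \<pi> T))
    = (\<Sum>K\<in>{K \<in> patterns A k. partial_inj K \<and> fst ` K \<subseteq> V}. hits K \<pi> * F (card K) K)"
    (is "_ = sum ?f ?X")
proof -
  have finV: "finite V" using V finite_A finite_subset by blast
  have g: "fst ` graph_on \<pi> T = T" "card (graph_on \<pi> T) = card T" "partial_inj (graph_on \<pi> T)"
    "graph_on \<pi> T \<subseteq> A \<times> A" if "T \<subseteq> V" for T
    using graph_on_facts[OF \<pi> _ finite_A, of T] that V by auto
  have "sum ?f ?X = sum ?f (graph_on \<pi> ` Pow V)"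
  proof (intro sum.mono_neutral_right ballI)
    show "finite ?X" using finite_patterns[OF finite_A] by simp
    show "graph_on \<pi> ` Pow V \<subseteq> ?X"
    proof
      fix K assume "K \<in> graph_on \<pi> ` Pow V"
      then obtain T where T: "T \<subseteq> V" "K = graph_on \<pi> T" by auto
      then show "K \<in> ?X"
        using g[OF T(1)] card_mono[OF finV T(1)] V(2) by (auto simp: patterns_def)
    qed
    fix K assume K: "K \<in> ?X - graph_on \<pi> ` Pow V"
    have "hits K \<pi> = 0"
    proof (rule ccontr)
      assume "hits K \<pi> \<noteq> 0"
      then have *: "\<pi> a = b" if "(a, b) \<in> K" for a b
        using that by (auto simp: hits_def split: if_splits)
      then have "K = graph_on \<pi> (fst ` K)" by (force simp: graph_on_def)
      then show False using K by blast
    qed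
    then show "?f K = 0" by simp
  qed
  also have "\<dots> = (\<Sum>T\<in>Pow V. ?f (graph_on \<pi> T))"
    using g(1) by (subst sum.reindex) (auto intro!: inj_on_inverseI[where g = "\<lambda>K. fst ` K"])
  also have "\<dots> = (\<Sum>T\<in>Pow V. F (card T) (graph_on \<pi> T))"
    using g(2) by (intro sum.cong refl) (auto simp: hits_def graph_on_def)
  finally show ?thesis by simp
qed

text \<open>
  The alternating sum over masks vanishes, and its term for the empty mask is \<open>hits L \<pi>\<close> up to the
  factor on the left. In each of the other terms \<open>\<pi>\<close> is replaced by surgered permutations.
\<close>

lemma reconstruction:
  assumes L: "L \<in> patterns A t" and \<pi>: "\<pi> permutes A"
  shows "real ((card shufflers)\<^sup>2) * hits L \<pi>
    = (\<Sum>\<kappa>\<in>sites. real_of_int (site_sign \<kappa>) * hits (site_pattern \<kappa>) \<pi> * hits L (site_perm \<kappa>))"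
proof -
  let ?P = "Pow {..2 * t}"
  define VV where "VV S = {V. V \<subseteq> A - W (Min S) \<and> card V \<le> 2 * t}" for S
  define KK where "KK V = {K \<in> patterns A (2 * t). partial_inj K \<and> fst ` K \<subseteq> V}" for V
  have "0 = (\<Sum>g\<in>shufflers. \<Sum>h\<in>shufflers. \<Sum>S\<in>?P. (-1) ^ card S * hits L (mask S g \<circ> \<pi> \<circ> mask S h))"
    using alternating_masks_vanish[OF L] by simp
  also have "\<dots> = (\<Sum>S\<in>?P. (-1) ^ card S * shuffled_hits S L \<pi>)"
    by (simp add: shuffled_hits_def sum_distrib_left sum.swap[of _ ?P])
  also have "\<dots> = shuffled_hits {} L \<pi> + (\<Sum>S\<in>?P - {{}}. (-1) ^ card S * shuffled_hits S L \<pi>)"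
    by (subst sum.remove[of _ "{}"]) auto
  also have "shuffled_hits {} L \<pi> = real ((card shufflers)\<^sup>2) * hits L \<pi>"
    by (simp add: shuffled_hits_def power2_eq_square)
  finally have "real ((card shufflers)\<^sup>2) * hits L \<pi> = (\<Sum>S\<in>?P - {{}}. - ((-1) ^ card S) * shuffled_hits S L \<pi>)"
    by (simp add: sum_negf)
  also have "\<dots> = (\<Sum>S\<in>?P - {{}}. - ((-1) ^ card S) * (\<Sum>V\<in>VV S. \<Sum>K\<in>KK V. hits K \<pi> *
      ((-1) ^ (card V + card K) * shuffled_hits S L (surgery A (W (Min S)) K))))"
  proof (intro sum.cong refl arg_cong2[where f = "(*)"])
    fix S assume S: "S \<in> ?P - {{}}"
    then have "Min S \<in> S" using finite_subset by (intro Min_in) auto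
    then have "shuffled_hits S L \<pi> = (\<Sum>V\<in>VV S. \<Sum>T\<in>Pow V.
      (-1) ^ (card V + card T) * shuffled_hits S L (surgery A (W (Min S)) (graph_on \<pi> T)))"
      using shuffled_hits_surgery[OF _ _ L \<pi>, of S "Min S"] S by (simp add: VV_def)
    also have "\<dots> = (\<Sum>V\<in>VV S. \<Sum>K\<in>KK V. hits K \<pi> *
      ((-1) ^ (card V + card K) * shuffled_hits S L (surgery A (W (Min S)) K)))"
      using sum_over_graphs[OF _ _ \<pi>, of _ "2 * t"
          "\<lambda>k K. (-1) ^ (card _ + k) * shuffled_hits S L (surgery A (W (Min S)) K)"]
      by (intro sum.cong refl) (auto simp: VV_def KK_def)
    finally show "shuffled_hits S L \<pi> = (\<Sum>V\<in>VV S. \<Sum>K\<in>KK V. hits K \<pi> *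
      ((-1) ^ (card V + card K) * shuffled_hits S L (surgery A (W (Min S)) K)))" .
  qed
  also have "\<dots> = (\<Sum>S\<in>?P - {{}}. \<Sum>V\<in>VV S. \<Sum>K\<in>KK V. \<Sum>g\<in>shufflers. \<Sum>h\<in>shufflers.
      real_of_int (site_sign (S, V, K, g, h)) * hits (site_pattern (S, V, K, g, h)) \<pi> * hits L (site_perm (S, V, K, g, h)))"
    unfolding shuffled_hits_def site_sign_def site_pattern_def site_perm_def
    by (simp add: sum_distrib_left power_add mult_ac)
  also have "\<dots> = (\<Sum>\<kappa>\<in>sites. real_of_int (site_sign \<kappa>) * hits (site_pattern \<kappa>) \<pi> * hits L (site_perm \<kappa>))"
  proof -
    have fin: "finite (VV S)" "finite (KK V)" for S V
      using finite_bounded_subsets[of "2 * t"] finite_patterns[OF finite_A]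
      by (auto simp: VV_def KK_def intro: rev_finite_subset)
    have eq: "sites = (SIGMA S:?P - {{}}. SIGMA V:VV S. KK V \<times> shufflers \<times> shufflers)"
      by (simp add: sites_def VV_def KK_def)
    show ?thesis
      unfolding eq
      by (simp add: sum.cartesian_product sum.Sigma fin finite_shufflers finite_SigmaI)
  qed
  finally show ?thesis .
qed

lemma sites_nonempty: "sites \<noteq> {}"
proof
  assume "sites = {}"
  then have "real ((card shufflers)\<^sup>2) * hits {} (id :: 'a \<Rightarrow> 'a) = 0"
    using reconstruction[of "{}" id] permutes_id by (auto simp: patterns_def)
  then show False using id_in_shufflers finite_shufflers by auto
qed

end

section \<open>Sequences of permutations with nearly uniform statistics\<close>

lemma exists_term_le_average:
  fixes f :: "'a \<Rightarrow> real"
  assumes "finite S" "S \<noteq> {}" "(\<Sum>x\<in>S. f x) = 0"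
  shows "\<exists>x\<in>S. f x \<le> 0"
proof (rule ccontr)
  assume "\<not> ?thesis"
  then have "0 < (\<Sum>x\<in>S. f x)" using assms(1,2) by (intro sum_pos) auto
  then show False using assms(3) by simp
qed

lemma freq_bounds:
  assumes "finite A"
  shows "0 \<le> freq A K" "freq A K \<le> 1"
proof -
  show "0 \<le> freq A K" by (auto simp: freq_def hits_nonneg intro!: divide_nonneg_pos sum_nonneg)
  have "(\<Sum>\<pi> | \<pi> permutes A. hits K \<pi>) \<le> (\<Sum>\<pi> | \<pi> permutes A. 1)"
    by (intro sum_mono hits_le_one)
  also have "\<dots> = fact (card A)" using card_permutations[OF refl assms] by simp
  finally show "freq A K \<le> 1" by (simp add: freq_def)
qed

lemma sum_deviation_eq_zero:
  assumes "finite A"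
  shows "(\<Sum>\<pi> | \<pi> permutes A. hits K \<pi> - freq A K) = 0"
  using card_permutations[OF refl assms] by (simp add: sum_subtractf freq_def)

text \<open>
  A greedy choice replaces a random one. The cross term between the accumulated deviation and the
  deviation of the next permutation has average zero, so some next permutation makes it nonpositive,
  and the sum of squares grows by at most the number of patterns.
\<close>

lemma balanced_sequence:
  assumes A: "finite A" and E: "finite E"
  shows "\<exists>g :: nat \<Rightarrow> 'a \<Rightarrow> 'a. (\<forall>l. g l permutes A) \<and>
    (\<Sum>K\<in>E. (\<Sum>l<r. hits K (g l) - freq A K)\<^sup>2) \<le> real r * real (card E)"
proof (induction r)
  case 0
  show ?case
  proof (rule exI[of _ "\<lambda>_. id"], rule conjI)
    show "\<forall>l :: nat. (id :: 'a \<Rightarrow> 'a) permutes A" using permutes_id by blast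
  qed simp
next
  case (Suc r)
  then obtain g :: "nat \<Rightarrow> 'a \<Rightarrow> 'a" where g: "\<And>l. g l permutes A"
    and bound: "(\<Sum>K\<in>E. (\<Sum>l<r. hits K (g l) - freq A K)\<^sup>2) \<le> real r * real (card E)" by blast
  define s where "s K = (\<Sum>l<r. hits K (g l) - freq A K)" for K
  define d where "d K \<pi> = hits K \<pi> - freq A K" for K and \<pi> :: "'a \<Rightarrow> 'a"
  have "(\<Sum>\<pi> | \<pi> permutes A. \<Sum>K\<in>E. s K * d K \<pi>) = 0"
    unfolding d_def by (subst sum.swap) (simp add: sum_deviation_eq_zero[OF A] flip: sum_distrib_left)
  moreover have "id \<in> {\<pi>. \<pi> permutes A}" by (simp add: permutes_id)
  ultimately obtain \<pi> where \<pi>: "\<pi> permutes A" "(\<Sum>K\<in>E. s K * d K \<pi>) \<le> 0"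
    using exists_term_le_average[OF finite_permutations[OF A]] by blast
  define g' where "g' = g(r := \<pi>)"
  have "(\<Sum>l<Suc r. hits K (g' l) - freq A K) = s K + d K \<pi>" for K
    by (simp add: g'_def s_def d_def)
  then have "(\<Sum>K\<in>E. (\<Sum>l<Suc r. hits K (g' l) - freq A K)\<^sup>2)
    = (\<Sum>K\<in>E. (s K)\<^sup>2) + 2 * (\<Sum>K\<in>E. s K * d K \<pi>) + (\<Sum>K\<in>E. (d K \<pi>)\<^sup>2)"
    by (simp add: power2_sum sum.distrib sum_distrib_left mult_ac)
  also have "(\<Sum>K\<in>E. (d K \<pi>)\<^sup>2) \<le> (\<Sum>K\<in>E. 1)"
  proof (intro sum_mono)
    fix K
    have "\<bar>d K \<pi>\<bar> \<le> 1"
      using freq_bounds[OF A, of K] hits_nonneg[of K \<pi>] hits_le_one[of K \<pi>] by (simp add: d_def)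
    then show "(d K \<pi>)\<^sup>2 \<le> 1" by (simp add: abs_square_le_1)
  qed
  finally have "(\<Sum>K\<in>E. (\<Sum>l<Suc r. hits K (g' l) - freq A K)\<^sup>2) \<le> real (Suc r) * real (card E)"
    using bound \<pi>(2) by (simp add: s_def algebra_simps)
  moreover have "g' l permutes A" for l using g \<pi>(1) by (simp add: g'_def)
  ultimately show ?case by blast
qed

section \<open>Exact weights of moderate size\<close>

text \<open>
  This divisibility is why the falling factorial is a factor of the number of translates below: the
  uniform statistics of that many permutations are integers.
\<close>

lemma falling_factorial_freq_Ints:
  assumes "finite A" "K \<in> patterns A k" "k \<le> card A"
  shows "real (\<Prod>i<k. card A - i) * freq A K \<in> \<int>"
proof (cases "partial_inj K")
  case False
  then show ?thesis by (simp add: freq_not_partial_inj)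
next
  case True
  note K = patternsD[OF assms(2,1)]
  have split: "(\<Prod>i<k. card A - i) = (\<Prod>i<card K. card A - i) * (\<Prod>i=card K..<k. card A - i)"
    using prod.atLeastLessThan_concat[of 0 "card K" k "\<lambda>i. card A - i"] K(3)
    by (simp add: atLeast0LessThan)
  have eq: "(\<Prod>i<card K. real (card A) - real i) = real (\<Prod>i<card K. card A - i)"
    using K(3) assms(3) by (simp add: of_nat_diff)
  have "(\<Prod>i<card K. card A - i) \<noteq> 0" using K(3) assms(3) by auto
  then have "real (\<Prod>i<k. card A - i) * freq A K = real (\<Prod>i=card K..<k. card A - i)"
    unfolding freq_partial_inj[OF assms(1) K(2) True] eq split of_nat_mult by simp
  then show ?thesis by (simp only: Ints_of_nat)
qed

text \<open>
  With \<open>z\<close> the deviation from uniformity of the multiset of all \<open>g\<^sub>i \<circ> b\<^sub>\<kappa>\<close>, the weights are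
  \<open>r Q - s\<^sub>\<kappa> z(g\<^sub>i P\<^sub>\<kappa>)\<close>. The constant part contributes \<open>r Q\<close> times the multiset, and the second part
  subtracts \<open>Q z\<close> once for each \<open>i\<close>, by the reconstruction identity moved by \<open>g\<^sub>i\<close>; what remains is
  exactly uniform. The value of \<open>r\<close> ensures \<open>\<bar>z\<bar> \<le> r\<close>, since \<open>z\<close> is of order
  \<open>card \<Lambda> * sqrt (r * card (patterns A k))\<close>, so that the weights are not negative.
\<close>

lemma exact_weights:
  fixes \<Lambda> :: "'b set" and A :: "'a set" and s :: "'b \<Rightarrow> int" and Q :: nat
  assumes A: "finite A" "k \<le> card A" and \<Lambda>: "finite \<Lambda>" "\<Lambda> \<noteq> {}" and Q: "0 < Q"
    and s: "\<And>\<kappa>. \<kappa> \<in> \<Lambda> \<Longrightarrow> \<bar>s \<kappa>\<bar> = 1"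
    and P: "\<And>\<kappa>. \<kappa> \<in> \<Lambda> \<Longrightarrow> P \<kappa> \<in> patterns A k"
    and b: "\<And>\<kappa>. \<kappa> \<in> \<Lambda> \<Longrightarrow> b \<kappa> permutes A"
    and rec: "\<And>L \<pi>. L \<in> patterns A t \<Longrightarrow> \<pi> permutes A \<Longrightarrow>
      real Q * hits L \<pi> = (\<Sum>\<kappa>\<in>\<Lambda>. real_of_int (s \<kappa>) * hits (P \<kappa>) \<pi> * hits L (b \<kappa>))"
  defines "r \<equiv> (\<Prod>i<k. card A - i) * (card \<Lambda>)\<^sup>2 * card (patterns A k)"
  shows "\<exists>w :: ('a \<Rightarrow> 'a) \<Rightarrow> nat. \<forall>L\<in>patterns A t.
    (\<Sum>\<pi> | \<pi> permutes A. real (w \<pi>) * hits L \<pi>) = real (r\<^sup>2 * Q * card \<Lambda>) * freq A L"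
proof -
  let ?E = "patterns A k"
  have finE: "finite ?E" by (rule finite_patterns[OF A(1)])
  have r: "(card \<Lambda>)\<^sup>2 * card ?E \<le> r"
    using A(2) by (simp add: r_def Suc_le_eq prod_pos)
  obtain g :: "nat \<Rightarrow> 'a \<Rightarrow> 'a" where g: "\<And>l. g l permutes A"
    and dev: "(\<Sum>K\<in>?E. (\<Sum>l<r. hits K (g l) - freq A K)\<^sup>2) \<le> real r * real (card ?E)"
    using balanced_sequence[OF A(1) finE, of r] by blast
  have dev_each: "\<bar>\<Sum>l<r. hits K (g l) - freq A K\<bar> \<le> sqrt (real r * real (card ?E))" if "K \<in> ?E" for K
  proof -
    have "(\<Sum>l<r. hits K (g l) - freq A K)\<^sup>2 \<le> (\<Sum>K\<in>?E. (\<Sum>l<r. hits K (g l) - freq A K)\<^sup>2)"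
      using that finE by (intro member_le_sum) auto
    then show ?thesis using dev by (intro real_le_rsqrt[of "\<bar>_\<bar>"]) simp
  qed
  \<comment> \<open>The defect of the multiset of all translates, as a linear functional.\<close>
  define Z :: "(('a \<Rightarrow> 'a) \<Rightarrow> real) \<Rightarrow> real" where
    "Z F = (\<Sum>l<r. \<Sum>\<mu>\<in>\<Lambda>. F (g l \<circ> b \<mu>)) - real r * real (card \<Lambda>) * ((\<Sum>\<pi> | \<pi> permutes A. F \<pi>) / fact (card A))" for F
  have Z_hits: "Z (hits K) = (\<Sum>l<r. \<Sum>\<mu>\<in>\<Lambda>. hits K (g l \<circ> b \<mu>)) - real r * real (card \<Lambda>) * freq A K" for K
    by (simp add: Z_def freq_def)
  have gb: "g l \<circ> b \<mu> permutes A" if "\<mu> \<in> \<Lambda>" for l \<mu>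
    using permutes_compose[OF b[OF that] g] .
  have Z_sum: "Z (\<lambda>\<pi>. \<Sum>\<kappa>\<in>\<Lambda>. c \<kappa> * F \<kappa> \<pi>) = (\<Sum>\<kappa>\<in>\<Lambda>. c \<kappa> * Z (F \<kappa>))" for c and F :: "'b \<Rightarrow> ('a \<Rightarrow> 'a) \<Rightarrow> real"
  proof -
    have "Z (\<lambda>\<pi>. \<Sum>\<kappa>\<in>\<Lambda>. c \<kappa> * F \<kappa> \<pi>)
      = (\<Sum>\<kappa>\<in>\<Lambda>. \<Sum>l<r. \<Sum>\<mu>\<in>\<Lambda>. c \<kappa> * F \<kappa> (g l \<circ> b \<mu>))
        - real r * real (card \<Lambda>) * ((\<Sum>\<kappa>\<in>\<Lambda>. \<Sum>\<pi> | \<pi> permutes A. c \<kappa> * F \<kappa> \<pi>) / fact (card A))"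
    proof -
      have "(\<Sum>l<r. \<Sum>\<mu>\<in>\<Lambda>. \<Sum>\<kappa>\<in>\<Lambda>. c \<kappa> * F \<kappa> (g l \<circ> b \<mu>))
        = (\<Sum>l<r. \<Sum>\<kappa>\<in>\<Lambda>. \<Sum>\<mu>\<in>\<Lambda>. c \<kappa> * F \<kappa> (g l \<circ> b \<mu>))"
        by (rule sum.cong[OF refl], rule sum.swap)
      also have "\<dots> = (\<Sum>\<kappa>\<in>\<Lambda>. \<Sum>l<r. \<Sum>\<mu>\<in>\<Lambda>. c \<kappa> * F \<kappa> (g l \<circ> b \<mu>))"
        by (rule sum.swap)
      finally show ?thesis
        unfolding Z_def using sum.swap[of "\<lambda>\<pi> \<kappa>. c \<kappa> * F \<kappa> \<pi>" \<Lambda> "{\<pi>. \<pi> permutes A}"] by simp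
    qed
    also have "\<dots> = (\<Sum>\<kappa>\<in>\<Lambda>. c \<kappa> * Z (F \<kappa>))"
      unfolding Z_def by (simp add: sum_subtractf right_diff_distrib sum_distrib_left sum_divide_distrib mult_ac)
    finally show ?thesis .
  qed
  have Z_cong: "Z F = Z G" if "\<And>\<pi>. \<pi> permutes A \<Longrightarrow> F \<pi> = G \<pi>" for F G
    unfolding Z_def using that gb by (intro arg_cong2[where f = "(-)"] arg_cong2[where f = "(*)"] arg_cong2[where f = "(/)"] sum.cong refl) auto
  have Z_scale: "Z (\<lambda>\<pi>. c * F \<pi>) = c * Z F" for c F
    by (simp add: Z_def sum_distrib_left right_diff_distrib mult_ac)
  have Z_bound: "\<bar>Z (hits K)\<bar> \<le> real r" if K: "K \<in> ?E" for K
  proof -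
    have "Z (hits K) = (\<Sum>\<mu>\<in>\<Lambda>. \<Sum>l<r. hits (map_prod (b \<mu>) id ` K) (g l) - freq A (map_prod (b \<mu>) id ` K))"
    proof -
      have "(\<Sum>l<r. \<Sum>\<mu>\<in>\<Lambda>. hits K (g l \<circ> b \<mu>)) = (\<Sum>\<mu>\<in>\<Lambda>. \<Sum>l<r. hits (map_prod (b \<mu>) id ` K) (g l))"
        unfolding hits_comp_right by (rule sum.swap)
      moreover have "(\<Sum>\<mu>\<in>\<Lambda>. freq A (map_prod (b \<mu>) id ` K)) = real (card \<Lambda>) * freq A K"
        using freq_map_prod_right[OF b] by simp
      ultimately show ?thesis
        by (simp add: Z_hits sum_subtractf mult_ac flip: sum_distrib_left)
    qed
    also have "\<bar>\<dots>\<bar> \<le> (\<Sum>\<mu>\<in>\<Lambda>. sqrt (real r * real (card ?E)))"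
    proof (rule order_trans[OF sum_abs], intro sum_mono dev_each)
      fix \<mu> assume "\<mu> \<in> \<Lambda>"
      then show "map_prod (b \<mu>) id ` K \<in> ?E"
        using permutes_image[OF b] by (intro map_prod_in_patterns[OF K A(1)]) auto
    qed
    also have "\<dots> = sqrt (real r * real ((card \<Lambda>)\<^sup>2 * card ?E))"
      by (simp add: real_sqrt_mult)
    also have "\<dots> \<le> sqrt (real r * real r)"
      using r by (intro real_sqrt_le_mono mult_left_mono of_nat_mono) auto
    finally show ?thesis by simp
  qed
  have Z_Ints: "Z (hits K) \<in> \<int>" if K: "K \<in> ?E" for K
  proof -
    have "real r * real (card \<Lambda>) * freq A K
      = real ((card \<Lambda>)\<^sup>2 * card ?E * card \<Lambda>) * (real (\<Prod>i<k. card A - i) * freq A K)"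
      by (simp add: r_def mult_ac)
    then have "real r * real (card \<Lambda>) * freq A K \<in> \<int>"
      using falling_factorial_freq_Ints[OF A(1) K A(2)] by (metis Ints_mult Ints_of_nat)
    then show ?thesis
      unfolding Z_hits by (intro Ints_diff Ints_sum) (auto intro: hits_in_Ints)
  qed
  have moved: "map_prod id (g i) ` P \<kappa> \<in> ?E" if "\<kappa> \<in> \<Lambda>" for i \<kappa>
    using permutes_image[OF g] by (intro map_prod_in_patterns[OF P[OF that] A(1)]) auto
  have rec_moved: "real Q * Z (hits L)
      = (\<Sum>\<kappa>\<in>\<Lambda>. real_of_int (s \<kappa>) * hits L (g i \<circ> b \<kappa>) * Z (hits (map_prod id (g i) ` P \<kappa>)))"
    if L: "L \<in> patterns A t" for L i
  proof -
    have "real Q * hits L \<pi> = (\<Sum>\<kappa>\<in>\<Lambda>. (real_of_int (s \<kappa>) * hits L (g i \<circ> b \<kappa>)) * hits (map_prod id (g i) ` P \<kappa>) \<pi>)"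
      if \<pi>: "\<pi> permutes A" for \<pi>
    proof -
      let ?L = "map_prod id (inv (g i)) ` L"
      have bij: "bij (g i)" "bij (inv (g i))"
        using permutes_bij[OF g] permutes_bij[OF permutes_inv[OF g]] .
      have inv: "inv (inv (g i)) = g i" using permutes_inv_inv[OF g] .
      have "g i \<circ> (inv (g i) \<circ> \<pi>) = \<pi>"
        using permutes_inv_o(1)[OF g[of i]] by (simp add: comp_assoc[symmetric])
      then have 1: "hits L \<pi> = hits ?L (inv (g i) \<circ> \<pi>)"
        using hits_comp_left[OF bij(1), of L "inv (g i) \<circ> \<pi>"] by simp
      have 2: "hits ?L (b \<kappa>) = hits L (g i \<circ> b \<kappa>)" for \<kappa>
        using hits_comp_left[OF bij(1)] by simp
      have 3: "hits (P \<kappa>) (inv (g i) \<circ> \<pi>) = hits (map_prod id (g i) ` P \<kappa>) \<pi>" for \<kappa>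
        using hits_comp_left[OF bij(2)] inv by simp
      have "?L \<in> patterns A t"
        using permutes_image[OF permutes_inv[OF g]] by (intro map_prod_in_patterns[OF L A(1)]) auto
      from rec[OF this permutes_compose[OF \<pi> permutes_inv[OF g[of i]]]]
      show ?thesis unfolding 1 2 3 by (simp add: mult_ac)
    qed
    from Z_cong[OF this] show ?thesis by (simp add: Z_scale Z_sum)
  qed
  define y where "y i \<kappa> = real (r * Q) - real_of_int (s \<kappa>) * Z (hits (map_prod id (g i) ` P \<kappa>))" for i \<kappa>
  have y_nat: "real (nat \<lfloor>y i \<kappa>\<rfloor>) = y i \<kappa>" if "\<kappa> \<in> \<Lambda>" for i \<kappa>
  proof -
    have "\<bar>real_of_int (s \<kappa>) * Z (hits (map_prod id (g i) ` P \<kappa>))\<bar> \<le> real r"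
      using Z_bound[OF moved[OF that]] s[OF that] by (simp add: abs_mult flip: of_int_abs)
    moreover have "real r \<le> real (r * Q)" using Q by (intro of_nat_mono) simp
    ultimately have "0 \<le> y i \<kappa>" unfolding y_def by linarith
    moreover have "y i \<kappa> \<in> \<int>" unfolding y_def
      using Z_Ints[OF moved[OF that]] by (intro Ints_diff Ints_mult) auto
    ultimately show ?thesis by (auto elim: Ints_cases)
  qed
  define J where "J = {..<r} \<times> \<Lambda>"
  define T where "T = (\<lambda>(i, \<kappa>). g i \<circ> b \<kappa>)"
  define w where "w \<pi> = (\<Sum>(i, \<kappa>)\<in>{j \<in> J. T j = \<pi>}. nat \<lfloor>y i \<kappa>\<rfloor>)" for \<pi>
  have finJ: "finite J" using \<Lambda>(1) by (simp add: J_def)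
  have "(\<Sum>\<pi> | \<pi> permutes A. real (w \<pi>) * hits L \<pi>) = real (r\<^sup>2 * Q * card \<Lambda>) * freq A L"
    if L: "L \<in> patterns A t" for L
  proof -
    have "(\<Sum>\<pi> | \<pi> permutes A. real (w \<pi>) * hits L \<pi>)
      = (\<Sum>\<pi> | \<pi> permutes A. \<Sum>j\<in>{j \<in> J. T j = \<pi>}. real (nat \<lfloor>y (fst j) (snd j)\<rfloor>) * hits L (T j))"
      by (simp add: w_def sum_distrib_right case_prod_beta)
    also have "\<dots> = (\<Sum>j\<in>J. real (nat \<lfloor>y (fst j) (snd j)\<rfloor>) * hits L (T j))"
      using gb by (intro sum.group[OF finJ finite_permutations[OF A(1)]]) (auto simp: J_def T_def)
    also have "\<dots> = (\<Sum>j\<in>J. y (fst j) (snd j) * hits L (T j))"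
      by (intro sum.cong refl) (auto simp: J_def y_nat)
    also have "\<dots> = (\<Sum>i<r. \<Sum>\<kappa>\<in>\<Lambda>. y i \<kappa> * hits L (g i \<circ> b \<kappa>))"
      by (simp add: J_def T_def sum.cartesian_product case_prod_beta)
    also have "\<dots> = (\<Sum>i<r. real (r * Q) * (\<Sum>\<kappa>\<in>\<Lambda>. hits L (g i \<circ> b \<kappa>)) - real Q * Z (hits L))"
    proof (rule sum.cong[OF refl])
      fix i
      have "(\<Sum>\<kappa>\<in>\<Lambda>. y i \<kappa> * hits L (g i \<circ> b \<kappa>)) = real (r * Q) * (\<Sum>\<kappa>\<in>\<Lambda>. hits L (g i \<circ> b \<kappa>))
        - (\<Sum>\<kappa>\<in>\<Lambda>. real_of_int (s \<kappa>) * hits L (g i \<circ> b \<kappa>) * Z (hits (map_prod id (g i) ` P \<kappa>)))"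
        unfolding y_def left_diff_distrib sum_subtractf sum_distrib_left by (simp add: mult_ac)
      then show "(\<Sum>\<kappa>\<in>\<Lambda>. y i \<kappa> * hits L (g i \<circ> b \<kappa>))
          = real (r * Q) * (\<Sum>\<kappa>\<in>\<Lambda>. hits L (g i \<circ> b \<kappa>)) - real Q * Z (hits L)"
        unfolding rec_moved[OF L, of i] .
    qed
    also have "\<dots> = real (r * Q) * ((\<Sum>i<r. \<Sum>\<kappa>\<in>\<Lambda>. hits L (g i \<circ> b \<kappa>)) - Z (hits L))"
      by (simp add: sum_subtractf sum_distrib_left algebra_simps)
    also have "\<dots> = real (r\<^sup>2 * Q * card \<Lambda>) * freq A L"
      unfolding Z_hits by (simp add: power2_eq_square)
    finally show ?thesis .
  qed
  then show ?thesis by blast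
qed

section \<open>Polynomial codes\<close>

text \<open>
  Linear factors can be split off one root at a time, because the differences of the roots are units
  modulo \<open>M\<close>; this takes the place of a prime modulus.
\<close>

lemma const_dvd_poly_of_roots:
  fixes p :: "int poly"
  assumes "finite X" "degree p < card X" "\<And>x. x \<in> X \<Longrightarrow> M dvd poly p x"
    and "\<And>x y. x \<in> X \<Longrightarrow> y \<in> X \<Longrightarrow> x \<noteq> y \<Longrightarrow> coprime M (x - y)"
  shows "[:M:] dvd p"
  using assms
proof (induction "card X" arbitrary: X p)
  case 0
  then show ?case by simp
next
  case (Suc n)
  then obtain c where c: "c \<in> X" by fastforce
  let ?q = "synthetic_div p c"
  have p: "p = [:-c, 1:] * ?q + [:poly p c:]" by (rule synthetic_div_correct'[symmetric])
  have root: "M dvd poly ?q x" if x: "x \<in> X - {c}" for x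
  proof -
    have "poly p x = (x - c) * poly ?q x + poly p c"
      by (subst p) (simp add: algebra_simps)
    then have "(x - c) * poly ?q x = poly p x - poly p c" by simp
    moreover have "M dvd poly p x - poly p c" using Suc.prems(3) x c by (intro dvd_diff) auto
    ultimately have "M dvd (x - c) * poly ?q x" by simp
    then show ?thesis
      using Suc.prems(4)[of x c] x c coprime_dvd_mult_right_iff[of M "x - c"] by auto
  qed
  have "[:M:] dvd ?q"
  proof (cases "n = 0")
    case True
    then have "degree p = 0" using Suc.prems(2) Suc.hyps(2) by simp
    then have "?q = 0" by (simp add: synthetic_div_eq_0_iff)
    then show ?thesis by simp
  next
    case False
    show ?thesis
    proof (rule Suc.hyps(1)[of "X - {c}"])
      show "n = card (X - {c})" using Suc.hyps(2) c Suc.prems(1) by simp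
      show "degree ?q < card (X - {c})"
        using Suc.hyps(2) Suc.prems(1,2) c False by (simp add: degree_synthetic_div)
    qed (use root Suc.prems in auto)
  qed
  moreover have "[:M:] dvd [:poly p c:]" using Suc.prems(3)[OF c] by simp
  ultimately show ?case by (subst p) (intro dvd_add dvd_mult)
qed

lemma coefficients_determined_mod:
  fixes a b :: "nat \<Rightarrow> nat" and M :: nat
  assumes X: "finite X" "card X = s"
    and co: "\<And>x y. x \<in> X \<Longrightarrow> y \<in> X \<Longrightarrow> x < y \<Longrightarrow> coprime M (y - x)"
    and range: "\<And>e. e < s \<Longrightarrow> a e < M \<and> b e < M"
    and eq: "\<And>x. x \<in> X \<Longrightarrow> int M dvd int (\<Sum>e<s. a e * x ^ e) - int (\<Sum>e<s. b e * x ^ e)"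
    and e: "e < s"
  shows "a e = b e"
proof -
  define p where "p = (\<Sum>e<s. monom (int (a e) - int (b e)) e)"
  have coeff: "coeff p e = int (a e) - int (b e)" if "e < s" for e
    using that by (simp add: p_def coeff_sum)
  have poly: "poly p (int x) = int (\<Sum>e<s. a e * x ^ e) - int (\<Sum>e<s. b e * x ^ e)" for x
    by (simp add: p_def poly_sum poly_monom left_diff_distrib sum_subtractf)
  have "[:int M:] dvd p"
  proof (rule const_dvd_poly_of_roots[of "int ` X"])
    have "degree p \<le> s - 1"
      unfolding p_def by (intro degree_sum_le) (auto intro!: order_trans[OF degree_monom_le])
    then show "degree p < card (int ` X)" using X e by (simp add: card_image)
    show "int M dvd poly p x" if "x \<in> int ` X" for x
      using that eq by (auto simp: poly simp del: of_nat_sum)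
    fix x y assume "x \<in> int ` X" "y \<in> int ` X" "x \<noteq> y"
    then obtain i j where ij: "x = int i" "y = int j" "i \<in> X" "j \<in> X" "i \<noteq> j" by auto
    show "coprime (int M) (x - y)"
    proof (cases "i < j")
      case True
      have "coprime (int M) (int (j - i))" using co[OF ij(3,4) True] by simp
      then have "coprime (int M) (- (x - y))" using True ij by (simp add: of_nat_diff)
      then show ?thesis by (simp only: coprime_minus_right_iff)
    next
      case False
      then have "j < i" using ij(5) by simp
      then have "coprime (int M) (int (i - j))" by (simp only: coprime_int_iff co[OF ij(4,3)])
      moreover have "int (i - j) = x - y" using False ij by (simp add: of_nat_diff)
      ultimately show ?thesis by metis
    qed
  qed (use X in simp)
  then have "int M dvd int (a e) - int (b e)"
    using coeff[OF e] by (metis const_poly_dvd_iff)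
  then have "int (a e) mod int M = int (b e) mod int M" by (simp only: mod_eq_dvd_iff)
  then show ?thesis using range[OF e] by simp
qed

text \<open>
  The value at \<open>k\<close> of a polynomial of degree less than \<open>m\<close>, whose coefficients are split into a free
  part \<open>u\<close> below \<open>t\<close> and a class \<open>c\<close> from \<open>t\<close> on.
\<close>

definition codeword :: "nat \<Rightarrow> nat \<Rightarrow> nat \<Rightarrow> (nat \<Rightarrow> nat) \<Rightarrow> (nat \<Rightarrow> nat) \<Rightarrow> nat \<Rightarrow> nat" where
  "codeword M t m c u k = ((\<Sum>e<t. u e * k ^ e) + (\<Sum>e=t..<m. c e * k ^ e)) mod M"

lemma codeword_eqD:
  assumes "codeword M t m c u k = codeword M t m c' u' k"
  shows "int M dvd int ((\<Sum>e<t. u e * k ^ e) + (\<Sum>e=t..<m. c e * k ^ e))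
    - int ((\<Sum>e<t. u' e * k ^ e) + (\<Sum>e=t..<m. c' e * k ^ e))"
proof -
  have "int (codeword M t m c u k) = int (codeword M t m c' u' k)" using assms by simp
  then show ?thesis unfolding codeword_def zmod_int mod_eq_dvd_iff .
qed

lemma codeword_less: "0 < M \<Longrightarrow> codeword M t m c u k < M"
  by (simp add: codeword_def)

lemma codeword_inj:
  assumes co: "\<And>x y. x < y \<Longrightarrow> y < m \<Longrightarrow> coprime M (y - x)" and tm: "t \<le> m"
    and c: "c \<in> {t..<m} \<rightarrow>\<^sub>E {..<M}" "c' \<in> {t..<m} \<rightarrow>\<^sub>E {..<M}"
    and u: "u \<in> {..<t} \<rightarrow>\<^sub>E {..<M}" "u' \<in> {..<t} \<rightarrow>\<^sub>E {..<M}"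
    and eq: "\<And>k. k < m \<Longrightarrow> codeword M t m c u k = codeword M t m c' u' k"
  shows "c = c'" "u = u'"
proof -
  define a where "a u c e = (if e < t then u e else c e)" for u c :: "nat \<Rightarrow> nat" and e
  have split: "(\<Sum>e<m. a u c e * k ^ e) = (\<Sum>e<t. u e * k ^ e) + (\<Sum>e=t..<m. c e * k ^ e)" for u c k
  proof -
    have "(\<Sum>e<m. a u c e * k ^ e) = (\<Sum>e<t. a u c e * k ^ e) + (\<Sum>e=t..<m. a u c e * k ^ e)"
      using sum.atLeastLessThan_concat[of 0 t m "\<lambda>e. a u c e * k ^ e"] tm by (simp add: atLeast0LessThan)
    then show ?thesis by (simp add: a_def)
  qed
  have range: "a u c e < M \<and> a u' c' e < M" if "e < m" for e
    using that c u by (auto simp: a_def PiE_def Pi_def)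
  have *: "a u c e = a u' c' e" if e: "e < m" for e
  proof (rule coefficients_determined_mod[of "{..<m}" m M "a u c" "a u' c'" e])
    fix x assume "x \<in> {..<m}"
    then show "int M dvd int (\<Sum>e<m. a u c e * x ^ e) - int (\<Sum>e<m. a u' c' e * x ^ e)"
      unfolding split by (intro codeword_eqD eq) simp
  qed (use co range e in auto)
  show "c = c'"
    using c *[unfolded a_def] by (intro PiE_ext[OF c]) (metis atLeastLessThan_iff not_le)
  show "u = u'"
    using *[unfolded a_def] tm by (intro PiE_ext[OF u]) (metis lessThan_iff less_le_trans)
qed

text \<open>
  Within each class the values at any \<open>t\<close> places are equidistributed. This makes the classes
  indistinguishable for statistics of order \<open>t\<close>.
\<close>

lemma codeword_bij:
  assumes co: "\<And>x y. x < y \<Longrightarrow> y < m \<Longrightarrow> coprime M (y - x)" and M: "0 < M"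
    and B: "B \<subseteq> {..<m}" "card B = t"
  shows "bij_betw (\<lambda>u. restrict (codeword M t m c u) B) ({..<t} \<rightarrow>\<^sub>E {..<M}) (B \<rightarrow>\<^sub>E {..<M})"
proof -
  let ?f = "\<lambda>u. restrict (codeword M t m c u) B" and ?U = "{..<t} \<rightarrow>\<^sub>E {..<M}" and ?V = "B \<rightarrow>\<^sub>E {..<M}"
  have finB: "finite B" using B(1) finite_subset by blast
  have "inj_on ?f ?U"
  proof (rule inj_onI)
    fix u u' assume u: "u \<in> ?U" "u' \<in> ?U" and eq: "?f u = ?f u'"
    have "codeword M t m c u k = codeword M t m c u' k" if "k \<in> B" for k
      using fun_cong[OF eq, of k] that by simp
    then have "int M dvd int (\<Sum>e<t. u e * k ^ e) - int (\<Sum>e<t. u' e * k ^ e)" if "k \<in> B" for k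
      using codeword_eqD[of M t m c u k c u'] that by simp
    then have "u e = u' e" if "e < t" for e
      using co B that u by (intro coefficients_determined_mod[OF finB B(2)]) (auto simp: PiE_def Pi_def)
    then show "u = u'" by (intro PiE_ext[OF u]) auto
  qed
  moreover have "?f ` ?U \<subseteq> ?V"
    by (rule image_subsetI, rule PiE_I) (simp_all add: codeword_less M)
  moreover have "finite ?V" "card ?V = card ?U"
    using finB B(2) by (simp_all add: card_PiE finite_PiE)
  ultimately have "?f ` ?U = ?V" by (intro card_subset_eq) (simp_all add: card_image)
  then show ?thesis using \<open>inj_on ?f ?U\<close> by (simp add: bij_betw_def)
qed

section \<open>Separating repeated permutations\<close>

text \<open>
  Permutations of \<open>Y\<close> are chosen one after the other. An earlier choice together with \<open>\<pi>\<close> and \<open>\<rho>\<close>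
  forbids at most one new permutation, because \<open>\<pi>\<close> is injective; hence there is always another one.
\<close>

lemma separated_permutations:
  fixes S :: "('a \<Rightarrow> 'a) set" and Y :: "'a set"
  assumes Y: "finite Y" and S: "finite S" "\<And>\<pi>. \<pi> \<in> S \<Longrightarrow> inj \<pi>"
    and size: "M * (card S)\<^sup>2 < fact (card Y)"
  shows "\<exists>s :: nat \<Rightarrow> 'a \<Rightarrow> 'a. (\<forall>a<M. s a permutes Y) \<and>
    (\<forall>a<M. \<forall>b<M. \<forall>\<pi>\<in>S. \<forall>\<rho>\<in>S. (\<forall>y\<in>Y. \<pi> (s a y) = \<rho> (s b y)) \<longrightarrow> a = b)"
  using size
proof (induction M)
  case 0
  then show ?case by simp
next
  case (Suc M)
  then have "M * (card S)\<^sup>2 < fact (card Y)" by simp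
  with Suc.IH obtain s :: "nat \<Rightarrow> 'a \<Rightarrow> 'a" where s: "\<And>a. a < M \<Longrightarrow> s a permutes Y"
    and sep: "\<And>a b \<pi> \<rho>. a < M \<Longrightarrow> b < M \<Longrightarrow> \<pi> \<in> S \<Longrightarrow> \<rho> \<in> S \<Longrightarrow> (\<forall>y\<in>Y. \<pi> (s a y) = \<rho> (s b y)) \<Longrightarrow> a = b"
    by blast
  define F where "F = {h. h permutes Y \<and> (\<exists>b<M. \<exists>\<pi>\<in>S. \<exists>\<rho>\<in>S. \<forall>y\<in>Y. \<pi> (h y) = \<rho> (s b y))}"
  have "\<exists>j. fst j < M \<and> fst (snd j) \<in> S \<and> snd (snd j) \<in> S \<and>
      (\<forall>y\<in>Y. fst (snd j) (h y) = snd (snd j) (s (fst j) y))" if "h \<in> F" for h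
    using that unfolding F_def by fastforce
  then have "\<forall>h. \<exists>j. h \<in> F \<longrightarrow> fst j < M \<and> fst (snd j) \<in> S \<and> snd (snd j) \<in> S \<and>
      (\<forall>y\<in>Y. fst (snd j) (h y) = snd (snd j) (s (fst j) y))" by blast
  from choice[OF this] obtain j where j: "fst (j h) < M" "fst (snd (j h)) \<in> S" "snd (snd (j h)) \<in> S"
    "\<forall>y\<in>Y. fst (snd (j h)) (h y) = snd (snd (j h)) (s (fst (j h)) y)" if "h \<in> F" for h
    by blast
  have "inj_on j F"
  proof (rule inj_onI)
    fix h h' assume h: "h \<in> F" "h' \<in> F" "j h = j h'"
    have "h y = h' y" for y
    proof (cases "y \<in> Y")
      case True
      then have "fst (snd (j h)) (h y) = fst (snd (j h)) (h' y)"
        using j(4)[OF h(1)] j(4)[OF h(2)] h(3) by simp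
      then show ?thesis using S(2)[OF j(2)[OF h(1)]] by (simp add: inj_eq)
    next
      case False
      moreover have "h permutes Y" "h' permutes Y" using h(1,2) unfolding F_def by blast+
      ultimately show ?thesis by (metis permutes_not_in)
    qed
    then show "h = h'" by blast
  qed
  moreover have "j ` F \<subseteq> {..<M} \<times> S \<times> S" using j(1-3) by (intro image_subsetI) (simp add: mem_Times_iff)
  ultimately have "card F \<le> card ({..<M} \<times> S \<times> S)"
    using S(1) by (intro card_inj_on_le) auto
  also have "\<dots> < fact (card Y)"
    using Suc.prems by (simp add: card_cartesian_product power2_eq_square)
  also have "\<dots> = card {h. h permutes Y}" using card_permutations[OF refl Y] by simp
  finally have "F \<noteq> {h. h permutes Y}" by blast
  moreover have "F \<subseteq> {h. h permutes Y}" by (auto simp: F_def)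
  ultimately obtain h where h: "h permutes Y" "h \<notin> F" by blast
  define s' where "s' = s(M := h)"
  have new: "\<not> (\<forall>y\<in>Y. \<pi> (h y) = \<rho> (s b y))" if "b < M" "\<pi> \<in> S" "\<rho> \<in> S" for b \<pi> \<rho>
    using h that by (auto simp: F_def)
  have "a = b" if ab: "a < Suc M" "b < Suc M" and S: "\<pi> \<in> S" "\<rho> \<in> S"
    and eq: "\<forall>y\<in>Y. \<pi> (s' a y) = \<rho> (s' b y)" for a b \<pi> \<rho>
  proof -
    consider "a < M" "b < M" | "a = M" "b = M" | "a = M" "b < M" | "a < M" "b = M"
      using ab by linarith
    then show ?thesis
    proof cases
      case 1
      then show ?thesis using sep[OF 1 S] eq by (simp add: s'_def)
    next
      case 3
      then show ?thesis using new[OF 3(2) S] eq by (simp add: s'_def)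
    next
      case 4
      then show ?thesis using new[OF 4(1) S(2) S(1)] eq by (simp add: s'_def)
    qed simp
  qed
  moreover have "s' a permutes Y" if "a < Suc M" for a
    using that s[of a] h(1) by (cases "a = M") (auto simp: s'_def)
  ultimately show ?case by blast
qed

text \<open>
  Acts on the \<open>k\<close>-th block, for \<open>k < m\<close>, by the \<open>v k\<close>-th of the permutations available there.
\<close>

definition twist :: "'a set \<Rightarrow> ('a \<Rightarrow> nat) \<Rightarrow> nat \<Rightarrow> (nat \<Rightarrow> nat \<Rightarrow> 'a \<Rightarrow> 'a) \<Rightarrow> (nat \<Rightarrow> nat) \<Rightarrow> 'a \<Rightarrow> 'a" where
  "twist A block m s v x = (if x \<in> A \<and> block x < m then s (block x) (v (block x)) x else x)"

lemma twist_permutes: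
  assumes A: "finite A" and s: "\<And>k. k < m \<Longrightarrow> s k (v k) permutes {x \<in> A. block x = k}"
  shows "twist A block m s v permutes A"
proof (rule inj_imp_permutes)
  have stay: "s (block x) (v (block x)) x \<in> A \<and> block (s (block x) (v (block x)) x) = block x"
    if "x \<in> A" "block x < m" for x
    using permutes_in_image[OF s[OF that(2)], of x] that by auto
  then have block: "twist A block m s v x \<in> A" "block (twist A block m s v x) = block x" if "x \<in> A" for x
    using that by (auto simp: twist_def)
  show "inj_on (twist A block m s v) A"
  proof (rule inj_onI)
    fix x y assume xy: "x \<in> A" "y \<in> A" "twist A block m s v x = twist A block m s v y"
    then have "block x = block y" using block by metis
    then show "x = y"
      using xy permutes_inj[OF s[of "block x"]] by (auto simp: twist_def inj_eq split: if_splits)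
  qed
  show "twist A block m s v x \<in> A" if "x \<in> A" for x using block that by blast
qed (use A in \<open>auto simp: twist_def\<close>)

text \<open>
  Each \<open>\<pi>\<close> is given \<open>w \<pi>\<close> classes of codewords and is composed with the twists by all their words.
  Equal compositions agree on every block, so by separation their codewords agree, and nothing
  is counted twice. A pattern of order \<open>t\<close> touches at most \<open>t\<close> blocks, so the class is irrelevant
  to it, and the sum over \<open>\<pi>\<close> with weights \<open>w\<close> makes the statistics uniform.
\<close>

lemma spread_weights:
  fixes w :: "('a \<Rightarrow> 'a) \<Rightarrow> nat" and block :: "'a \<Rightarrow> nat"
  assumes A: "finite A" and tm: "t \<le> m" and M: "0 < M"
    and co: "\<And>x y. x < y \<Longrightarrow> y < m \<Longrightarrow> coprime M (y - x)"
    and w: "\<And>L. L \<in> patterns A t \<Longrightarrow> (\<Sum>\<pi> | \<pi> permutes A. real (w \<pi>) * hits L \<pi>) = real N * freq A L"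
    and N: "N \<le> M ^ (m - t)"
    and blocks: "\<And>k. k < m \<Longrightarrow> M * N\<^sup>2 < fact (card {x \<in> A. block x = k})"
  shows "\<exists>T. T \<subseteq> {\<pi>. \<pi> permutes A} \<and> card T = N * M ^ t \<and>
    (\<forall>L\<in>patterns A t. (\<Sum>\<sigma>\<in>T. hits L \<sigma>) = real (card T) * freq A L)"
proof -
  define S where "S = {\<pi>. \<pi> permutes A \<and> 0 < w \<pi>}"
  have finS: "finite S" using finite_permutations[OF A] by (auto simp: S_def intro: rev_finite_subset)
  have over_S: "(\<Sum>\<pi>\<in>S. real (w \<pi>) * F \<pi>) = (\<Sum>\<pi> | \<pi> permutes A. real (w \<pi>) * F \<pi>)" for F
    using finite_permutations[OF A] by (intro sum.mono_neutral_left) (auto simp: S_def)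
  have "real (\<Sum>\<pi>\<in>S. w \<pi>) = real N"
    using w[of "{}"] over_S[of "\<lambda>_. 1"] freq_partial_inj[OF A, of "{}"]
    by (simp add: patterns_def partial_inj_def)
  then have total: "(\<Sum>\<pi>\<in>S. w \<pi>) = N" by (simp only: of_nat_eq_iff)
  have w_le: "w \<pi> \<le> N" if "\<pi> \<in> S" for \<pi>
    using member_le_sum[OF that, of w] finS total by simp
  have "card S = (\<Sum>\<pi>\<in>S. 1)" by simp
  also have "\<dots> \<le> (\<Sum>\<pi>\<in>S. w \<pi>)" by (intro sum_mono) (auto simp: S_def)
  finally have card_S: "card S \<le> N" using total by simp
  define good where "good k s \<longleftrightarrow> (\<forall>a<M. s a permutes {x \<in> A. block x = k}) \<and>
    (\<forall>a<M. \<forall>b<M. \<forall>\<pi>\<in>S. \<forall>\<rho>\<in>S. (\<forall>y\<in>{x \<in> A. block x = k}. \<pi> (s a y) = \<rho> (s b y)) \<longrightarrow> a = b)"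
    for k and s :: "nat \<Rightarrow> 'a \<Rightarrow> 'a"
  have "\<exists>s. good k s" if k: "k < m" for k
    unfolding good_def
  proof (rule separated_permutations[OF _ finS])
    show "finite {x \<in> A. block x = k}" using A by simp
    show "inj \<pi>" if "\<pi> \<in> S" for \<pi> using that permutes_inj by (auto simp: S_def)
    have "M * (card S)\<^sup>2 \<le> M * N\<^sup>2" using card_S by (simp add: power_mono)
    then show "M * (card S)\<^sup>2 < fact (card {x \<in> A. block x = k})" using blocks[OF k] by linarith
  qed
  then have "\<forall>k. \<exists>s. k < m \<longrightarrow> good k s" by blast
  from choice[OF this] obtain s where good: "\<And>k. k < m \<Longrightarrow> good k (s k)" by blast
  have s: "s k a permutes {x \<in> A. block x = k}" if "k < m" "a < M" for k a
    using good[OF that(1)] that(2) unfolding good_def by blast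
  have sep: "a = b" if "k < m" "a < M" "b < M" "\<pi> \<in> S" "\<rho> \<in> S"
      "\<forall>y\<in>{x \<in> A. block x = k}. \<pi> (s k a y) = \<rho> (s k b y)" for k a b \<pi> \<rho>
    using good[OF that(1)] that(2-) unfolding good_def by blast
  let ?tw = "twist A block m s"
  have tw: "?tw v permutes A" if "\<And>k. k < m \<Longrightarrow> v k < M" for v
    using twist_permutes[OF A, of m s v block] s that by blast
  let ?U = "{..<t} \<rightarrow>\<^sub>E {..<M}" and ?C = "{t..<m} \<rightarrow>\<^sub>E {..<M}"
  have finU: "finite ?U" and card_U: "card ?U = M ^ t"
    by (simp_all add: card_PiE finite_PiE)
  have card_C: "card ?C = M ^ (m - t)" by (simp add: card_PiE)
  have "\<exists>C. C \<subseteq> ?C \<and> card C = w \<pi>" if "\<pi> \<in> S" for \<pi>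
  proof -
    have "w \<pi> \<le> card ?C" using w_le[OF that] N card_C by linarith
    then show ?thesis using obtain_subset_with_card_n by metis
  qed
  then have "\<forall>\<pi>. \<exists>C. \<pi> \<in> S \<longrightarrow> C \<subseteq> ?C \<and> card C = w \<pi>" by blast
  from choice[OF this] obtain C
    where C: "\<And>\<pi>. \<pi> \<in> S \<Longrightarrow> C \<pi> \<subseteq> ?C" "\<And>\<pi>. \<pi> \<in> S \<Longrightarrow> card (C \<pi>) = w \<pi>" by blast
  have finC: "finite (C \<pi>)" if "\<pi> \<in> S" for \<pi>
    using C(1)[OF that] by (rule finite_subset) (simp add: finite_PiE)
  let ?cw = "codeword M t m"
  define J where "J = (SIGMA \<pi>:S. C \<pi> \<times> ?U)"
  define \<Phi> :: "('a \<Rightarrow> 'a) \<times> (nat \<Rightarrow> nat) \<times> (nat \<Rightarrow> nat) \<Rightarrow> 'a \<Rightarrow> 'a"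
    where "\<Phi> = (\<lambda>(\<pi>, c, u). \<pi> \<circ> ?tw (?cw c u))"
  have "inj_on \<Phi> J"
  proof (rule inj_onI)
    fix i j assume ij: "i \<in> J" "j \<in> J" "\<Phi> i = \<Phi> j"
    obtain \<pi> c u where i: "i = (\<pi>, c, u)" "\<pi> \<in> S" "c \<in> ?C" "u \<in> ?U"
      using ij(1) C(1) unfolding J_def by blast
    obtain \<rho> c' u' where j: "j = (\<rho>, c', u')" "\<rho> \<in> S" "c' \<in> ?C" "u' \<in> ?U"
      using ij(2) C(1) unfolding J_def by blast
    have eq: "\<pi> \<circ> ?tw (?cw c u) = \<rho> \<circ> ?tw (?cw c' u')"
      using ij(3) i(1) j(1) by (simp add: \<Phi>_def)
    have "?cw c u k = ?cw c' u' k" if k: "k < m" for k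
    proof (rule sep[OF k codeword_less[OF M] codeword_less[OF M] i(2) j(2)], rule ballI)
      fix y assume "y \<in> {x \<in> A. block x = k}"
      then show "\<pi> (s k (?cw c u k) y) = \<rho> (s k (?cw c' u' k) y)"
        using fun_cong[OF eq, of y] k by (simp add: twist_def)
    qed
    then have cu: "c = c'" "u = u'"
      using codeword_inj[OF co tm i(3) j(3) i(4) j(4)] by blast+
    have "?tw (?cw c u) permutes A" using codeword_less[OF M] by (intro tw) auto
    then have surj: "surj (?tw (?cw c u))" by (rule permutes_surj)
    have "\<pi> = \<rho>"
    proof
      fix x
      obtain y where "x = ?tw (?cw c u) y" using surjD[OF surj] by blast
      then show "\<pi> x = \<rho> x" using fun_cong[OF eq, of y] cu by simp
    qed
    then show "i = j" using i j cu by simp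
  qed
  define T where "T = \<Phi> ` J"
  have flat: "(\<Sum>\<sigma>\<in>T. F \<sigma>) = (\<Sum>\<pi>\<in>S. \<Sum>c\<in>C \<pi>. \<Sum>u\<in>?U. F (\<pi> \<circ> ?tw (?cw c u)))" for F :: "('a \<Rightarrow> 'a) \<Rightarrow> real"
  proof -
    have "(\<Sum>\<sigma>\<in>T. F \<sigma>) = (\<Sum>j\<in>J. F (\<Phi> j))"
      unfolding T_def using \<open>inj_on \<Phi> J\<close> by (simp add: sum.reindex)
    then show ?thesis
      unfolding J_def \<Phi>_def using finS finC finU
      by (simp add: sum.cartesian_product sum.Sigma case_prod_beta)
  qed
  have "real (card T) = (\<Sum>\<sigma>\<in>T. 1)" by simp
  also have "\<dots> = real (\<Sum>\<pi>\<in>S. w \<pi>) * real (M ^ t)"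
    unfolding flat using C(2) card_U by (simp add: sum_distrib_right)
  also have "\<dots> = real (N * M ^ t)" unfolding total by simp
  finally have card_T: "card T = N * M ^ t" by (simp only: of_nat_eq_iff)
  have T_sub: "T \<subseteq> {\<pi>. \<pi> permutes A}"
    using tw codeword_less[OF M] by (auto simp: T_def J_def \<Phi>_def S_def intro!: permutes_compose)
  have uniform: "(\<Sum>\<sigma>\<in>T. hits L \<sigma>) = real (card T) * freq A L" if L: "L \<in> patterns A t" for L
  proof -
    note L' = patternsD[OF L A]
    have "card (block ` fst ` L \<inter> {..<m}) \<le> card (block ` fst ` L)"
      using L'(1) by (intro card_mono) auto
    also have "\<dots> \<le> t"
      using card_image_le[of "fst ` L" block] card_image_le[of L fst] L' by simp
    finally obtain B where B: "block ` fst ` L \<inter> {..<m} \<subseteq> B" "B \<subseteq> {..<m}" "card B = t"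
      using exists_subset_between[of "block ` fst ` L \<inter> {..<m}" t "{..<m}"] tm by auto
    let ?V = "B \<rightarrow>\<^sub>E {..<M}"
    \<comment> \<open>Outside \<open>B\<close> the word is irrelevant to \<open>L\<close>, but it must still name an available permutation.\<close>
    define ext where "ext v k = (if k \<in> B then v k else 0)" for v :: "nat \<Rightarrow> nat" and k
    have finB: "finite B" using B(2) finite_subset by blast
    have local: "hits L (\<pi> \<circ> ?tw v) = hits L (\<pi> \<circ> ?tw (ext (restrict v B)))" for \<pi> v
    proof -
      have "?tw v a = ?tw (ext (restrict v B)) a" if "(a, b) \<in> L" for a b
      proof (cases "block a < m")
        case True
        then have "block a \<in> B" using B(1) that by force
        then show ?thesis by (simp add: twist_def ext_def)
      qed (simp add: twist_def)
      then show ?thesis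
        unfolding hits_def by (intro arg_cong[where f = of_bool] ball_cong refl) auto
    qed
    have "(\<Sum>\<sigma>\<in>T. hits L \<sigma>)
      = (\<Sum>\<pi>\<in>S. \<Sum>c\<in>C \<pi>. \<Sum>u\<in>?U. hits L (\<pi> \<circ> ?tw (ext (restrict (?cw c u) B))))"
      unfolding flat by (simp only: local[symmetric])
    also have "\<dots> = (\<Sum>\<pi>\<in>S. \<Sum>c\<in>C \<pi>. \<Sum>v\<in>?V. hits L (\<pi> \<circ> ?tw (ext v)))"
      by (intro sum.cong[OF refl] sum.reindex_bij_betw[OF codeword_bij[OF co M B(2,3)]])
    also have "\<dots> = (\<Sum>\<pi>\<in>S. \<Sum>v\<in>?V. real (w \<pi>) * hits L (\<pi> \<circ> ?tw (ext v)))"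
      using C(2) by (simp add: sum_distrib_left)
    also have "\<dots> = (\<Sum>v\<in>?V. \<Sum>\<pi>\<in>S. real (w \<pi>) * hits L (\<pi> \<circ> ?tw (ext v)))"
      by (rule sum.swap)
    also have "\<dots> = (\<Sum>v\<in>?V. real N * freq A L)"
    proof (rule sum.cong[OF refl])
      fix v assume v: "v \<in> ?V"
      have p: "?tw (ext v) permutes A" using v M by (intro tw) (auto simp: ext_def)
      have "map_prod (?tw (ext v)) id ` L \<in> patterns A t"
        using permutes_image[OF p] by (intro map_prod_in_patterns[OF L A]) auto
      then show "(\<Sum>\<pi>\<in>S. real (w \<pi>) * hits L (\<pi> \<circ> ?tw (ext v))) = real N * freq A L"
        unfolding hits_comp_right over_S using w freq_map_prod_right[OF p] by simp
    qed
    also have "\<dots> = real (card T) * freq A L"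
      using B(3) finB by (simp add: card_T card_PiE)
    finally show ?thesis .
  qed
  show ?thesis using T_sub card_T uniform by blast
qed

section \<open>Parameters and the size bound\<close>

lemma t_wise_permutation_of_uniform:
  assumes T: "T \<subseteq> {\<pi>. \<pi> permutes {1..n}}"
    and uniform: "\<And>L. L \<in> patterns {1..n} t \<Longrightarrow> (\<Sum>\<sigma>\<in>T. hits L \<sigma>) = real (card T) * freq {1..n} L"
  shows "t_wise_permutation n t T"
  unfolding t_wise_permutation_def
proof (intro conjI ballI)
  show "T \<subseteq> perms_of n" using T by (simp add: perms_of_def)
  fix xs ys assume "xs \<in> distinct_tuples n t" "ys \<in> distinct_tuples n t"
  then have xs: "length xs = t" "distinct xs" "set xs \<subseteq> {1..n}"
    and ys: "length ys = t" "distinct ys" "set ys \<subseteq> {1..n}"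
    by (auto simp: distinct_tuples_def)
  define K where "K = set (zip xs ys)"
  have finT: "finite T" using T finite_permutations[of "{1..n}"] finite_subset by blast
  have card_K: "card K = t"
    using xs ys by (simp add: K_def distinct_card distinct_zipI1)
  have K_sub: "K \<subseteq> {1..n} \<times> {1..n}"
    using xs ys unfolding K_def by (auto dest: set_zip_leftD set_zip_rightD)
  have "map fst (zip xs ys) = xs" "map snd (zip xs ys) = ys" using xs ys by simp_all
  then have pi: "partial_inj K"
    unfolding partial_inj_def K_def using xs(2) ys(2) by (metis distinct_map)
  have hits_K: "hits K \<sigma> = of_bool (\<forall>k<t. \<sigma> (xs ! k) = ys ! k)" for \<sigma>
    using xs(1) ys(1) by (auto simp: hits_def K_def set_zip)
  have "real (card {\<sigma> \<in> T. \<forall>k<t. \<sigma> (xs ! k) = ys ! k}) = (\<Sum>\<sigma>\<in>T. hits K \<sigma>)"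
    using finT by (simp add: hits_K sum.If_cases of_bool_def Int_def)
  also have "\<dots> = real (card T) * freq {1..n} K"
    using K_sub card_K by (intro uniform) (simp add: patterns_def)
  also have "freq {1..n} K = 1 / (\<Prod>k<t. real n - real k)"
    using freq_partial_inj[OF _ K_sub pi] card_K by simp
  finally show "real (card {\<sigma> \<in> T. \<forall>k<t. \<sigma> (xs ! k) = ys ! k})
      = 1 / (\<Prod>k<t. real n - real k) * real (card T)"
    by simp
qed

lemma fact_ge_power: "k ^ j \<le> (fact (k + j) :: nat)"
proof (induction j)
  case (Suc j)
  have "k ^ Suc j \<le> Suc (k + j) * fact (k + j)"
    unfolding power_Suc using Suc.IH by (intro mult_le_mono) auto
  also have "\<dots> = fact (k + Suc j)" by simp
  finally show ?case .
qed (simp add: Suc_le_eq)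

text \<open>
  The exponent \<open>81 t\<close> collects the falling factorial, the number of sites and the number of patterns
  in \<open>r\<^sup>2 Q (card sites)\<close>; the other factor bounds the twelfth power of the number of shufflers, which
  permute at most \<open>6 t\<^sup>2\<close> points.
\<close>

lemma exact_weights_main_regime:
  assumes t: "1 \<le> t" and n: "6 * t\<^sup>2 \<le> n" "2 \<le> n"
  obtains w :: "(nat \<Rightarrow> nat) \<Rightarrow> nat" and N :: nat
  where "0 < N" "N \<le> n ^ (81 * t) * ((6 * t\<^sup>2) ^ (6 * t\<^sup>2)) ^ 12"
    "\<And>L. L \<in> patterns {1..n} t \<Longrightarrow>
      (\<Sum>\<pi> | \<pi> permutes {1..n}. real (w \<pi>) * hits L \<pi>) = real N * freq {1..n} L"
proof -
  let ?A = "{1..n}"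
  define W where "W j = {j * (2 * t) + 1..(j + 1) * (2 * t)}" for j
  have tt: "(2 * t + 1) * (2 * t) \<le> 6 * t\<^sup>2"
    using t by (simp add: power2_eq_square algebra_simps)
  have W_within: "W j \<subseteq> {1..(2 * t + 1) * (2 * t)}" if "j \<le> 2 * t" for j
  proof -
    have "(j + 1) * (2 * t) \<le> (2 * t + 1) * (2 * t)" using that by (intro mult_le_mono1) simp
    then show ?thesis unfolding W_def by auto
  qed
  have disj: "W i \<inter> W j = {}" if "i < j" for i j
  proof -
    have "(i + 1) * (2 * t) \<le> j * (2 * t)" using that by (intro mult_le_mono1) simp
    then show ?thesis unfolding W_def by auto
  qed
  interpret buffers ?A W t
  proof
    show "W j \<subseteq> ?A" if "j \<le> 2 * t" for j
    proof -
      have "{1..(2 * t + 1) * (2 * t)} \<subseteq> ?A" using tt n(1) by auto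
      then show ?thesis using W_within[OF that] by blast
    qed
    show "disjoint_family_on W {..2 * t}"
      using disj unfolding disjoint_family_on_def by (metis Int_commute linorder_neqE_nat)
    show "2 * t \<le> card (W j)" for j by (simp add: W_def)
  qed simp
  define \<gamma> where "\<gamma> = card shufflers"
  have "card (\<Union>j\<le>2 * t. W j) \<le> card {1..(2 * t + 1) * (2 * t)}"
    using W_within by (intro card_mono UN_least) auto
  then have cardU: "card (\<Union>j\<le>2 * t. W j) \<le> 6 * t\<^sup>2" using tt by simp
  have "\<gamma> \<le> fact (card (\<Union>j\<le>2 * t. W j))"
    unfolding \<gamma>_def using card_shufflers_le by simp
  also have "\<dots> \<le> fact (6 * t\<^sup>2)" using cardU by (rule fact_mono)
  also have "\<dots> \<le> (6 * t\<^sup>2) ^ (6 * t\<^sup>2)"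
    using fact_le_power[of "6 * t\<^sup>2", where 'a = nat] by simp
  finally have \<gamma>_le: "\<gamma> \<le> (6 * t\<^sup>2) ^ (6 * t\<^sup>2)" .
  have \<gamma>_pos: "0 < \<gamma>"
    using id_in_shufflers finite_shufflers by (auto simp: \<gamma>_def card_gt_0_iff)
  define s where "s = card sites"
  define E where "E = card (patterns ?A (2 * t))"
  define D where "D = (\<Prod>i<2 * t. n - i)"
  have n1: "n + 1 \<le> n ^ 2" and n2: "n\<^sup>2 + 1 \<le> n ^ 3"
  proof -
    have "n * 2 \<le> n * n" using n(2) by (intro mult_le_mono2)
    then show "n + 1 \<le> n ^ 2" using n(2) unfolding power2_eq_square by linarith
    have "n\<^sup>2 * 2 \<le> n\<^sup>2 * n" using n(2) by (intro mult_le_mono2)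
    moreover have "1 \<le> n\<^sup>2" "n ^ 3 = n\<^sup>2 * n" using n(2) by (auto simp: power2_eq_square power3_eq_cube)
    ultimately show "n\<^sup>2 + 1 \<le> n ^ 3" by linarith
  qed
  have E_le: "E \<le> n ^ (6 * t)"
  proof -
    have "E \<le> (n\<^sup>2 + 1) ^ (2 * t)" unfolding E_def using card_patterns_le[of ?A "2 * t"] by simp
    also have "\<dots> \<le> (n ^ 3) ^ (2 * t)" using n2 by (rule power_mono) simp
    finally show ?thesis by (simp flip: power_mult)
  qed
  have D_le: "D \<le> n ^ (2 * t)"
    unfolding D_def using prod_mono[of "{..<2 * t}" "\<lambda>i. n - i" "\<lambda>_. n"] by simp
  have s_le: "s \<le> n ^ (13 * t) * \<gamma>\<^sup>2"
  proof -
    have "s \<le> 2 ^ (2 * t + 1) * ((n + 1) ^ (2 * t) * ((n\<^sup>2 + 1) ^ (2 * t) * \<gamma>\<^sup>2))"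
      unfolding s_def \<gamma>_def using card_sites_le by simp
    also have "\<dots> \<le> n ^ (3 * t) * ((n ^ 2) ^ (2 * t) * ((n ^ 3) ^ (2 * t) * \<gamma>\<^sup>2))"
    proof (intro mult_le_mono power_mono n1 n2 le_refl)
      have "(2::nat) ^ (2 * t + 1) \<le> 2 ^ (3 * t)" using t by (intro power_increasing) auto
      also have "\<dots> \<le> n ^ (3 * t)" using n(2) by (rule power_mono) simp
      finally show "2 ^ (2 * t + 1) \<le> n ^ (3 * t)" .
    qed auto
    also have "\<dots> = n ^ (3 * t + (2 * (2 * t) + 3 * (2 * t))) * \<gamma>\<^sup>2"
      by (simp only: power_mult[symmetric] power_add mult_ac)
    finally show ?thesis by simp
  qed
  define r where "r = D * s\<^sup>2 * E"
  define N where "N = r\<^sup>2 * \<gamma>\<^sup>2 * s"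
  have "2 * t \<le> 6 * t\<^sup>2" using t by (simp add: power2_eq_square)
  then have k: "2 * t \<le> card ?A" using n(1) by simp
  have "\<exists>w. \<forall>L\<in>patterns ?A t. (\<Sum>\<pi> | \<pi> permutes ?A. real (w \<pi>) * hits L \<pi>)
      = real (((\<Prod>i<2 * t. card ?A - i) * (card sites)\<^sup>2 * card (patterns ?A (2 * t)))\<^sup>2 * \<gamma>\<^sup>2 * card sites) * freq ?A L"
  proof (rule exact_weights[OF _ k finite_sites sites_nonempty])
    show "0 < \<gamma>\<^sup>2" using \<gamma>_pos by simp
  qed (use site_sign_abs site_pattern_in site_perm_permutes reconstruction in \<open>auto simp: \<gamma>_def\<close>)
  then obtain w where w: "\<And>L. L \<in> patterns ?A t \<Longrightarrow>
      (\<Sum>\<pi> | \<pi> permutes ?A. real (w \<pi>) * hits L \<pi>) = real N * freq ?A L"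
    unfolding N_def r_def D_def s_def E_def by auto
  have pos: "0 < N"
  proof -
    have "0 < s" using finite_sites sites_nonempty by (simp add: s_def card_gt_0_iff)
    moreover have "{} \<in> patterns ?A (2 * t)" by (simp add: patterns_def)
    then have "0 < E" using finite_patterns[of ?A "2 * t"] by (auto simp: E_def card_gt_0_iff)
    moreover have "0 < D" unfolding D_def using k by (intro prod_pos) auto
    ultimately show ?thesis using \<gamma>_pos by (simp add: N_def r_def)
  qed
  have "N \<le> (n ^ (2 * t) * (n ^ (13 * t) * \<gamma>\<^sup>2)\<^sup>2 * n ^ (6 * t))\<^sup>2 * \<gamma>\<^sup>2 * (n ^ (13 * t) * \<gamma>\<^sup>2)"
    unfolding N_def r_def using D_le s_le E_le
    by (intro mult_le_mono power_mono) auto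
  also have "\<dots> = n ^ (81 * t) * \<gamma> ^ 12"
  proof -
    have "(x ^ (2 * t) * (x ^ (13 * t) * c\<^sup>2)\<^sup>2 * x ^ (6 * t))\<^sup>2 * c\<^sup>2 * (x ^ (13 * t) * c\<^sup>2)
      = (x ^ (4 * t) * x ^ (52 * t) * x ^ (12 * t) * x ^ (13 * t)) * (c ^ 8 * c ^ 2 * c ^ 2)" for x c :: nat
      by (simp add: power_mult_distrib mult_ac flip: power_mult)
    then show ?thesis by (simp flip: power_add)
  qed
  also have "\<dots> \<le> n ^ (81 * t) * ((6 * t\<^sup>2) ^ (6 * t\<^sup>2)) ^ 12"
    using \<gamma>_le by (intro mult_le_mono2 power_mono) auto
  finally show thesis using that pos w by blast
qed

text \<open>
  The assumption on \<open>n\<close> leaves room for \<open>m\<close> blocks, \<open>m\<close> of order \<open>t\<^sup>2\<close>, whose size is at least twice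
  the square root of \<open>n\<close>. The order of the symmetric group of such a block then exceeds the modulus
  times the square of the total weight, as the separation requires.
\<close>

lemma main_regime:
  assumes t: "1 \<le> t" and n: "1000000 * t ^ 4 \<le> n"
  shows "\<exists>T. T \<noteq> {} \<and> t_wise_permutation n t T \<and>
    card T \<le> n ^ (83 * t) * (154 * t\<^sup>2) ^ (226 * t ^ 3)"
proof -
  define a where "a = t\<^sup>2"
  have a: "1 \<le> a" "t \<le> a" using t by (auto simp: a_def power2_eq_square)
  have na: "1000000 * (a * a) \<le> n" using n by (simp add: a_def power2_eq_square power4_eq_xxxx mult_ac)
  have "a \<le> a * a" using a by simp
  then have n6: "6 * a \<le> n" and n154: "154 * a \<le> n" and n2: "2 \<le> n" using na a by linarith+
  obtain w N where N: "0 < N" "N \<le> n ^ (81 * t) * ((6 * t\<^sup>2) ^ (6 * t\<^sup>2)) ^ 12"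
    and w: "\<And>L. L \<in> patterns {1..n} t \<Longrightarrow>
      (\<Sum>\<pi> | \<pi> permutes {1..n}. real (w \<pi>) * hits L \<pi>) = real N * freq {1..n} L"
    using that by (rule exact_weights_main_regime[OF t n6[unfolded a_def] n2])
  \<comment> \<open>The total weight is at most \<open>n\<close> to the power \<open>153 a\<close>, and the modulus exceeds \<open>n\<close>, so that
    \<open>m - t = 153 a\<close> high coefficients suffice to number the copies.\<close>
  define m where "m = t + 153 * a"
  \<comment> \<open>One more than a multiple of \<open>m!\<close>, hence coprime to all differences of places below \<open>m\<close>.\<close>
  define M where "M = n * fact m + 1"
  have m154: "m \<le> 154 * a" and m_pos: "0 < m" using a by (auto simp: m_def)
  have N_le: "N \<le> n ^ (153 * a)"
  proof -
    have "N \<le> n ^ (81 * t) * ((6 * a) ^ (6 * a)) ^ 12" using N(2) by (simp add: a_def)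
    also have "\<dots> \<le> n ^ (81 * t) * (n ^ (6 * a)) ^ 12"
      using n6 by (intro mult_le_mono2 power_mono) auto
    also have "\<dots> = n ^ (81 * t + 72 * a)" by (simp add: power_add flip: power_mult)
    also have "\<dots> \<le> n ^ (153 * a)" using a n2 by (intro power_increasing) auto
    finally show ?thesis .
  qed
  have n_le_M: "n \<le> M"
    using mult_le_mono2[OF fact_ge_1, of n m] unfolding M_def by linarith
  have "N \<le> n ^ (153 * a)" by (rule N_le)
  also have "\<dots> \<le> M ^ (153 * a)" using n_le_M by (rule power_mono) simp
  finally have N_M: "N \<le> M ^ (m - t)" by (simp add: m_def)
  have co: "coprime M (y - x)" if xy: "x < y" "y < m" for x y
  proof -
    have "y - x dvd fact m" using xy by (intro dvd_fact) auto
    then have d: "y - x dvd n * fact m" by simp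
    show ?thesis
    proof (rule coprimeI)
      fix c assume "c dvd M" "c dvd y - x"
      then have "c dvd n * fact m + 1" "c dvd n * fact m" using d dvd_trans by (auto simp: M_def)
      then show "is_unit c" using dvd_add_right_iff by blast
    qed
  qed
  define b where "b = n div m"
  define k where "k = n div (308 * a)"
  have nk: "n < 308 * a * (k + 1)"
    using dividend_less_times_div[of "308 * a" n] a by (simp add: k_def)
  have k925: "925 * a \<le> k"
  proof (rule ccontr)
    assume "\<not> ?thesis"
    then have "k + 1 \<le> 925 * a" by simp
    then have "308 * a * (k + 1) \<le> 308 * a * (925 * a)" by (rule mult_le_mono2)
    then show False using nk na by simp
  qed
  have kn: "n \<le> k\<^sup>2"
  proof -
    have "925 * n \<le> 308 * (925 * a) * (k + 1)" using nk by simp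
    also have "\<dots> \<le> 308 * k * (k + 1)" using k925 by (intro mult_le_mono) auto
    also have "\<dots> \<le> 308 * k * (2 * k)" using k925 a by (intro mult_le_mono) auto
    also have "\<dots> \<le> 925 * k\<^sup>2" by (simp add: power2_eq_square)
    finally show ?thesis by simp
  qed
  have k2b: "k + k \<le> b"
  proof -
    have "k * (308 * a) \<le> n" by (simp add: k_def)
    moreover have "(k + k) * m \<le> (k + k) * (154 * a)" using m154 by (rule mult_le_mono2)
    moreover have "(k + k) * (154 * a) = k * (308 * a)" by simp
    ultimately have "(k + k) * m \<le> n" by linarith
    then show ?thesis unfolding b_def using m_pos by (simp add: less_eq_div_iff_mult_less_eq)
  qed
  have b_pos: "0 < b" using k2b k925 a by simp
  have M_le: "M \<le> n ^ 2 * fact m"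
  proof -
    have "n * 2 \<le> n * n" using n2 by (intro mult_le_mono2)
    then have "n * 2 * fact m \<le> n * n * fact m" by (rule mult_le_mono1)
    moreover have "1 * 1 \<le> n * fact m" using n2 by (intro mult_le_mono fact_ge_1) simp
    ultimately show ?thesis unfolding M_def power2_eq_square by linarith
  qed
  have fact_m: "fact m \<le> (154 * a) ^ (154 * a)"
  proof -
    have "fact m \<le> (fact (154 * a) :: nat)" using m154 by (rule fact_mono)
    also have "\<dots> \<le> (154 * a) ^ (154 * a)" using fact_le_power[of "154 * a", where 'a = nat] by simp
    finally show ?thesis .
  qed
  have small: "M * N\<^sup>2 < fact b"
  proof -
    have "fact m \<le> n ^ (154 * a)"
      using fact_m power_mono[OF n154, of "154 * a"] by simp
    then have "M \<le> n ^ 2 * n ^ (154 * a)" using M_le by (meson le_trans mult_le_mono2)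
    then have "M * N\<^sup>2 \<le> (n ^ 2 * n ^ (154 * a)) * (n ^ (153 * a))\<^sup>2"
      using N_le by (intro mult_le_mono power_mono) auto
    also have "\<dots> = n ^ (2 + 154 * a + 153 * a * 2)" by (simp only: power_add power_mult[symmetric])
    also have "\<dots> \<le> n ^ (462 * a)" using a n2 by (intro power_increasing) auto
    also have "\<dots> \<le> (k\<^sup>2) ^ (462 * a)" using kn by (rule power_mono) simp
    also have "\<dots> = k ^ (924 * a)" by (simp flip: power_mult)
    also have "\<dots> < k ^ (925 * a)" using k925 a by (intro power_strict_increasing) auto
    also have "\<dots> \<le> k ^ k" using k925 a by (intro power_increasing) auto
    also have "\<dots> \<le> fact (k + k)" by (rule fact_ge_power)
    also have "\<dots> \<le> fact b" using k2b by (rule fact_mono)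
    finally show ?thesis .
  qed
  define block where "block x = (x - 1) div b" for x :: nat
  have block_card: "card {x \<in> {1..n}. block x = j} = b" if j: "j < m" for j
  proof -
    have "(j + 1) * b \<le> m * b" using j by (intro mult_le_mono1) simp
    also have "\<dots> \<le> n" by (simp add: b_def)
    finally have jb: "j * b + b \<le> n" by simp
    have iff: "block x = j \<longleftrightarrow> j * b + 1 \<le> x \<and> x \<le> j * b + b" if "1 \<le> x" for x
    proof -
      have "block x = j \<longleftrightarrow> j * b \<le> x - 1 \<and> x - 1 < (j + 1) * b"
        unfolding block_def using b_pos
        by (metis Suc_eq_plus1 div_nat_eqI div_times_less_eq_dividend dividend_less_div_times mult.commute mult_Suc)
      then show ?thesis using that by auto
    qed
    have "{x \<in> {1..n}. block x = j} = {j * b + 1..j * b + b}"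
    proof (intro set_eqI iffI)
      fix x assume "x \<in> {x \<in> {1..n}. block x = j}"
      then show "x \<in> {j * b + 1..j * b + b}" using iff[of x] by simp
    next
      fix x assume x: "x \<in> {j * b + 1..j * b + b}"
      then have "1 \<le> x" "x \<le> n" using jb by auto
      then show "x \<in> {x \<in> {1..n}. block x = j}" using iff[of x] x by simp
    qed
    then show ?thesis by simp
  qed
  have "\<exists>T. T \<subseteq> {\<pi>. \<pi> permutes {1..n}} \<and> card T = N * M ^ t \<and>
    (\<forall>L\<in>patterns {1..n} t. (\<Sum>\<sigma>\<in>T. hits L \<sigma>) = real (card T) * freq {1..n} L)"
  proof (rule spread_weights[of "{1..n}" t m M w N block])
    show "M * N\<^sup>2 < fact (card {x \<in> {1..n}. block x = j})" if "j < m" for j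
      using small block_card[OF that] by simp
  qed (use co w N_M in \<open>auto simp: m_def M_def\<close>)
  then obtain T where T: "T \<subseteq> {\<pi>. \<pi> permutes {1..n}}" "card T = N * M ^ t"
    and uniform: "\<And>L. L \<in> patterns {1..n} t \<Longrightarrow> (\<Sum>\<sigma>\<in>T. hits L \<sigma>) = real (card T) * freq {1..n} L"
    by blast
  have "card T \<le> (n ^ (81 * t) * ((6 * a) ^ (6 * a)) ^ 12) * (n ^ 2 * (154 * a) ^ (154 * a)) ^ t"
    unfolding T(2)
  proof (intro mult_le_mono power_mono)
    show "N \<le> n ^ (81 * t) * ((6 * a) ^ (6 * a)) ^ 12" using N(2) by (simp add: a_def)
    show "M \<le> n ^ 2 * (154 * a) ^ (154 * a)"
      using M_le fact_m by (meson le_trans mult_le_mono2)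
  qed simp
  also have "\<dots> \<le> (n ^ (81 * t) * ((154 * a) ^ (6 * a)) ^ 12) * (n ^ 2 * (154 * a) ^ (154 * a)) ^ t"
    by (intro mult_le_mono1 mult_le_mono2 power_mono) auto
  also have "\<dots> = n ^ (83 * t) * (154 * a) ^ (72 * a + 154 * (a * t))"
  proof -
    have "(x ^ (81 * t) * (c ^ (6 * a)) ^ 12) * (x ^ 2 * c ^ (154 * a)) ^ t
      = x ^ (83 * t) * c ^ (72 * a + 154 * (a * t))" for x c :: nat
    proof -
      have "(x ^ (81 * t) * (c ^ (6 * a)) ^ 12) * (x ^ 2 * c ^ (154 * a)) ^ t
        = (x ^ (81 * t) * x ^ (2 * t)) * (c ^ (72 * a) * c ^ (154 * (a * t)))"
        by (simp add: power_mult_distrib mult_ac flip: power_mult)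
      then show ?thesis by (simp flip: power_add)
    qed
    then show ?thesis .
  qed
  also have "\<dots> \<le> n ^ (83 * t) * (154 * a) ^ (226 * t ^ 3)"
  proof (intro mult_le_mono2 power_increasing)
    have "a \<le> a * t" "a * t = t ^ 3"
      using t by (auto simp: a_def power2_eq_square power3_eq_cube)
    then show "72 * a + 154 * (a * t) \<le> 226 * t ^ 3" by simp
  qed (use a in simp)
  finally have "card T \<le> n ^ (83 * t) * (154 * t\<^sup>2) ^ (226 * t ^ 3)" by (simp add: a_def)
  moreover have "t_wise_permutation n t T"
    by (rule t_wise_permutation_of_uniform[OF T(1) uniform])
  moreover have "T \<noteq> {}" using T(2) N(1) by (auto simp: M_def)
  ultimately show ?thesis by blast
qed

lemma small_ground_set:
  "\<exists>T. T \<noteq> {} \<and> t_wise_permutation n t T \<and> card T \<le> n ^ n"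
proof (intro exI[of _ "{\<pi>. \<pi> permutes {1..n}}"] conjI)
  have card: "card {\<pi>. \<pi> permutes {1..n}} = fact n"
    using card_permutations[of "{1..n}" n] by simp
  then show "card {\<pi>. \<pi> permutes {1..n}} \<le> n ^ n" using fact_le_power[of n, where 'a = nat] by simp
  show "{\<pi>. \<pi> permutes {1..n}} \<noteq> {}" using permutes_id by blast
  show "t_wise_permutation n t {\<pi>. \<pi> permutes {1..n}}"
    by (rule t_wise_permutation_of_uniform) (simp_all add: card[simplified] freq_def)
qed

text \<open>
  The constant of the theorem is chosen generously. For \<open>t = 1\<close> the factor \<open>exp (t powr c)\<close> does not
  grow with \<open>c\<close>, so there every constant has to be absorbed by the power of \<open>n\<close>; for \<open>t \<ge> 2\<close>
  constants are absorbed by powers of \<open>t\<close>.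
\<close>

lemma power_absorbed:
  fixes x :: real
  assumes "1 \<le> n" "1 \<le> t" "x \<le> real n ^ e" "e \<le> 1000000 * t"
  shows "x \<le> exp (real t powr 1000000) * real n powr (1000000 * real t)"
proof -
  have "x \<le> real n powr real e" using assms by (simp add: powr_realpow)
  also have "\<dots> \<le> real n powr (1000000 * real t)"
    using assms of_nat_mono[OF assms(4), where 'a = real] by (intro powr_mono) auto
  also have "\<dots> \<le> exp (real t powr 1000000) * real n powr (1000000 * real t)"
    using mult_right_mono[of 1 "exp (real t powr 1000000)" "real n powr (1000000 * real t)"] by simp
  finally show ?thesis .
qed

lemma exponential_absorbed:
  fixes x :: real
  assumes "1 \<le> n" "2 \<le> t" "x \<le> exp (10 ^ 12 * real t ^ 8) * real n ^ (83 * t)"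
  shows "x \<le> exp (real t powr 1000000) * real n powr (1000000 * real t)"
proof -
  have "(10::real) ^ 12 \<le> 2 ^ 40" by simp
  also have "\<dots> \<le> real t ^ 40" using assms by (intro power_mono) auto
  finally have "10 ^ 12 * real t ^ 8 \<le> real t ^ 40 * real t ^ 8" by (intro mult_right_mono) auto
  also have "\<dots> = real t powr 48" using assms by (simp add: powr_numeral flip: power_add)
  also have "\<dots> \<le> real t powr 1000000" using assms by (intro powr_mono) auto
  finally have 1: "exp (10 ^ 12 * real t ^ 8) \<le> exp (real t powr 1000000)" by simp
  have "real n ^ (83 * t) = real n powr real (83 * t)"
    using assms by (subst powr_realpow) auto
  also have "\<dots> \<le> real n powr (1000000 * real t)" using assms by (intro powr_mono) auto
  finally have 2: "real n ^ (83 * t) \<le> real n powr (1000000 * real t)" .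
  show ?thesis using assms(3) mult_mono[OF 1 2] by simp
qed

lemma power_le_exp:
  fixes x :: real
  assumes "0 \<le> x"
  shows "x ^ k \<le> exp (real k * x)"
proof -
  have "x \<le> exp x" using exp_ge_add_one_self[of x] by linarith
  then have "x ^ k \<le> exp x ^ k" using assms by (rule power_mono)
  then show ?thesis by (simp add: exp_of_nat_mult)
qed

theorem theorem1p3:
  "\<exists>c::real. c > 0 \<and>
     (\<forall>n t :: nat. 1 \<le> n \<longrightarrow> 1 \<le> t \<longrightarrow> t \<le> n \<longrightarrow>
        (\<exists>T. T \<noteq> {} \<and> t_wise_permutation n t T \<and>
             real (card T) \<le> exp (real t powr c) * real n powr (c * real t)))"
proof (intro exI[of _ "1000000 :: real"] conjI allI impI)
  fix n t :: nat assume n: "1 \<le> n" and t: "1 \<le> t" and "t \<le> n"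
  show "\<exists>T. T \<noteq> {} \<and> t_wise_permutation n t T \<and>
      real (card T) \<le> exp (real t powr 1000000) * real n powr (1000000 * real t)"
  proof (cases "1000000 * t ^ 4 \<le> n")
    case True
    obtain T where T: "T \<noteq> {}" "t_wise_permutation n t T"
      and size: "card T \<le> n ^ (83 * t) * (154 * t\<^sup>2) ^ (226 * t ^ 3)"
      using main_regime[OF t True] by blast
    have "real (card T) \<le> exp (real t powr 1000000) * real n powr (1000000 * real t)"
    proof (cases "t = 1")
      case t1: True
      have "154 * t\<^sup>2 \<le> n" using True t1 by simp
      then have "n ^ (83 * t) * (154 * t\<^sup>2) ^ (226 * t ^ 3) \<le> n ^ (83 * t) * n ^ (226 * t ^ 3)"
        by (intro mult_le_mono2 power_mono) auto
      with size have "card T \<le> n ^ (83 * t + 226 * t ^ 3)" by (simp only: power_add)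
      then have "real (card T) \<le> real (n ^ (83 * t + 226 * t ^ 3))" by (rule of_nat_mono)
      then have "real (card T) \<le> real n ^ (83 * t + 226 * t ^ 3)" by (simp only: of_nat_power)
      moreover have "83 * t + 226 * t ^ 3 \<le> 1000000 * t" using t1 by simp
      ultimately show ?thesis by (rule power_absorbed[OF n t])
    next
      case False
      then have t2: "2 \<le> t" using t by simp
      have "real ((154 * t\<^sup>2) ^ (226 * t ^ 3)) \<le> exp (real (226 * t ^ 3) * real (154 * t\<^sup>2))"
        using power_le_exp[of "real (154 * t\<^sup>2)" "226 * t ^ 3"] by simp
      also have "\<dots> \<le> exp (10 ^ 12 * real t ^ 8)"
      proof -
        have "real (226 * t ^ 3) * real (154 * t\<^sup>2) = 34804 * real t ^ 5"
          by (simp flip: power_add)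
        also have "\<dots> \<le> 10 ^ 12 * real t ^ 8"
          using t by (intro mult_mono power_increasing) auto
        finally show ?thesis by simp
      qed
      finally have e: "real ((154 * t\<^sup>2) ^ (226 * t ^ 3)) \<le> exp (10 ^ 12 * real t ^ 8)" .
      have "real (card T) \<le> real (n ^ (83 * t) * (154 * t\<^sup>2) ^ (226 * t ^ 3))"
        using size by (rule of_nat_mono)
      also have "\<dots> = real ((154 * t\<^sup>2) ^ (226 * t ^ 3)) * real n ^ (83 * t)" by simp
      also have "\<dots> \<le> exp (10 ^ 12 * real t ^ 8) * real n ^ (83 * t)"
        using e by (rule mult_right_mono) simp
      finally show ?thesis by (rule exponential_absorbed[OF n t2])
    qed
    then show ?thesis using T by blast
  next
    case False
    obtain T where T: "T \<noteq> {}" "t_wise_permutation n t T" and size: "card T \<le> n ^ n"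
      using small_ground_set by blast
    have size': "real (card T) \<le> real n ^ n"
      using of_nat_mono[OF size, where 'a = real] by simp
    have "real (card T) \<le> exp (real t powr 1000000) * real n powr (1000000 * real t)"
    proof (cases "t = 1")
      case t1: True
      then have "n \<le> 1000000 * t" using False by simp
      then show ?thesis by (rule power_absorbed[OF n t size'])
    next
      case t1: False
      then have t2: "2 \<le> t" using t by simp
      have "real n \<le> 10 ^ 6 * real t ^ 4"
        using False of_nat_mono[of n "1000000 * t ^ 4", where 'a = real] by simp
      then have "real n * real n \<le> (10 ^ 6 * real t ^ 4) * (10 ^ 6 * real t ^ 4)"
        by (intro mult_mono) auto
      also have "\<dots> = 10 ^ 12 * real t ^ 8" by (simp flip: power_add)
      finally have "exp (real n * real n) \<le> exp (10 ^ 12 * real t ^ 8)" by simp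
      moreover have "real n ^ n \<le> exp (real n * real n)" by (rule power_le_exp) simp
      ultimately have "real (card T) \<le> exp (10 ^ 12 * real t ^ 8) * 1" using size' by linarith
      also have "\<dots> \<le> exp (10 ^ 12 * real t ^ 8) * real n ^ (83 * t)"
        using n by (intro mult_left_mono one_le_power) auto
      finally show ?thesis by (rule exponential_absorbed[OF n t2])
    qed
    then show ?thesis using T by blast
  qed
qed simp

end
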